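(* Let $K$ be an abstract simplicial complex with vertex set $\{1,2,\ldots,m\}$, and let $\underline{G}=\{(G_i,e_i)\}_{i=1}^m$ be a family of locally compact connected $\mathrm{CW}$ topological groups, where $e_i$ is the neutral element of $G_i$. Assume that $\underline{G}$ is LS-logarithmic, i.e. $$\mathsf{cat}(G_{i_1}\times\cdots\times G_{i_k})=\mathsf{cat}(G_{i_1})+\cdots+\mathsf{cat}(G_{i_k})$$ for every strictly increasing sequence $1\leq i_1<\cdots<i_k\leq m$. Then $$\mathsf{TC}(\underline{G}^K)=\mathsf{TC}^M(\underline{G}^K)=\max\Big\{\sum_{i\in\sigma_1\cup\sigma_2}\mathsf{cat}(G_i)\colon \sigma_1,\sigma_2\in K\Big\}.$$
   Context: $\mathsf{cat}(X)$ denotes the (reduced) Lusternik–Schnirelmann category: the least $n\ge 0$ such that $X$ is covered by $n+1$ open sets each of which is contractible within $X$. The polyhedral product is $\underline{G}^K=\bigcup_{\sigma\in K}\underline{G}^{\sigma}\subseteq\prod_{i=1}^m G_i$, where $\underline{G}^{\sigma}=\prod_{i=1}^m Y_i$ with $Y_i=G_i$ if $i\in\sigma$ and $Y_i=\{e_i\}$ if $i\notin\sigma$. For a path-connected space $X$, let $e_{01}\colon X^{[0,1]}\to X\times X$, $\gamma\mapsto(\gamma(0),\gamma(1))$. Farber's topological complexity $\mathsf{TC}(X)$ is the least $n$ such that $X\times X$ admits an open cover $\{U_0,\ldots,U_n\}$ with a continuous section $s_i\colon U_i\to X^{[0,1]}$ of $e_{01}$ on each $U_i$ ($\infty$ if none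 exists). The (Iwase–Sakai) monoidal topological complexity $\mathsf{TC}^M(X)$ is the least $n$ such that $X\times X$ admits an open cover $\{U_0,\ldots,U_n\}$ with each $U_i$ containing the diagonal $\Delta X=\{(x,x)\}$ and continuous sections $s_i\colon U_i\to X^{[0,1]}$ of $e_{01}$ with $s_i(x,x)$ the constant path at $x$ for all $x\in X$ ($\infty$ if none exists). *)

theory Defs
  imports "HOL-Analysis.Analysis" "HOL-Algebra.Group" "HOL-Library.Extended_Nat"
begin

text \<open>The space nat => real carries the product topology (euclidean); on the subspace of
functions vanishing from index n on, this is the Euclidean topology of R^n.\<close>

definition cdisc :: "nat \<Rightarrow> (nat \<Rightarrow> real) set" where
  "cdisc n = {x. (\<forall>i\<ge>n. x i = 0) \<and> (\<Sum>i<n. (x i)^2) \<le> 1}"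

definition odisc :: "nat \<Rightarrow> (nat \<Rightarrow> real) set" where
  "odisc n = {x. (\<forall>i\<ge>n. x i = 0) \<and> (\<Sum>i<n. (x i)^2) < 1}"

definition bsphere :: "nat \<Rightarrow> (nat \<Rightarrow> real) set" where
  "bsphere n = {x. (\<forall>i\<ge>n. x i = 0) \<and> (\<Sum>i<n. (x i)^2) = 1}"

definition cw_complex :: "'a topology \<Rightarrow> bool" where
  "cw_complex X \<longleftrightarrow> Hausdorff_space X \<and>
    (\<exists>C :: (nat \<times> ((nat \<Rightarrow> real) \<Rightarrow> 'a)) set.
      (\<forall>(n, \<phi>)\<in>C. continuous_map (subtopology euclidean (cdisc n)) X \<phi> \<and>
          homeomorphic_map (subtopology euclidean (odisc n)) (subtopology X (\<phi> ` odisc n)) \<phi>) \<and>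
      (\<forall>c\<in>C. \<forall>d\<in>C. c \<noteq> d \<longrightarrow> snd c ` odisc (fst c) \<inter> snd d ` odisc (fst d) = {}) \<and>
      (\<Union>(n, \<phi>)\<in>C. \<phi> ` odisc n) = topspace X \<and>
      (\<forall>(n, \<phi>)\<in>C. \<exists>F\<subseteq>C. finite F \<and> (\<forall>(k, \<psi>)\<in>F. k < n) \<and>
          \<phi> ` bsphere n \<subseteq> (\<Union>(k, \<psi>)\<in>F. \<psi> ` odisc k)) \<and>
      (\<forall>A\<subseteq>topspace X. closedin X A \<longleftrightarrow> (\<forall>(n, \<phi>)\<in>C. closedin X (A \<inter> \<phi> ` cdisc n))))"

definition topological_group :: "('a, 'b) monoid_scheme \<Rightarrow> 'a topology \<Rightarrow> bool" where
  "topological_group G T \<longleftrightarrow> group G \<and> carrier G = topspace T \<and>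
     continuous_map (prod_topology T T) T (\<lambda>(x, y). x \<otimes>\<^bsub>G\<^esub> y) \<and>
     continuous_map T T (\<lambda>x. inv\<^bsub>G\<^esub> x)"

definition cat_le :: "'a topology \<Rightarrow> nat \<Rightarrow> bool" where
  "cat_le X n \<longleftrightarrow> (\<exists>U :: nat \<Rightarrow> 'a set.
     (\<forall>i\<le>n. openin X (U i) \<and>
        (\<exists>c. homotopic_with (\<lambda>_. True) (subtopology X (U i)) X id (\<lambda>_. c))) \<and>
     topspace X \<subseteq> (\<Union>i\<le>n. U i))"

definition LS_cat :: "'a topology \<Rightarrow> enat" where
  "LS_cat X = Inf {enat n | n. cat_le X n}"

text \<open>A continuous section U -> X^[0,1] of the endpoint evaluation e01 is encoded, via the
exponential law ([0,1] is locally compact Hausdorff), as a continuous map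
H : U x [0,1] -> X with H((x,y),0) = x and H((x,y),1) = y.\<close>

definition motion_planner :: "'a topology \<Rightarrow> ('a \<times> 'a) set \<Rightarrow> (('a \<times> 'a) \<times> real \<Rightarrow> 'a) \<Rightarrow> bool" where
  "motion_planner X U H \<longleftrightarrow>
     continuous_map (prod_topology (subtopology (prod_topology X X) U) (top_of_set {0..1})) X H \<and>
     (\<forall>p\<in>U. H (p, 0) = fst p \<and> H (p, 1) = snd p)"

definition TC_le :: "'a topology \<Rightarrow> nat \<Rightarrow> bool" where
  "TC_le X n \<longleftrightarrow> (\<exists>U :: nat \<Rightarrow> ('a \<times> 'a) set.
     (\<forall>i\<le>n. openin (prod_topology X X) (U i) \<and> (\<exists>H. motion_planner X (U i) H)) \<and>
     topspace (prod_topology X X) \<subseteq> (\<Union>i\<le>n. U i))"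

definition TC :: "'a topology \<Rightarrow> enat" where
  "TC X = Inf {enat n | n. TC_le X n}"

definition TCM_le :: "'a topology \<Rightarrow> nat \<Rightarrow> bool" where
  "TCM_le X n \<longleftrightarrow> (\<exists>U :: nat \<Rightarrow> ('a \<times> 'a) set.
     (\<forall>i\<le>n. openin (prod_topology X X) (U i) \<and>
        {(x, x) | x. x \<in> topspace X} \<subseteq> U i \<and>
        (\<exists>H. motion_planner X (U i) H \<and>
             (\<forall>x\<in>topspace X. \<forall>t\<in>{0..1}. H ((x, x), t) = x))) \<and>
     topspace (prod_topology X X) \<subseteq> (\<Union>i\<le>n. U i))"

definition TCM :: "'a topology \<Rightarrow> enat" where
  "TCM X = Inf {enat n | n. TCM_le X n}"

definition simplicial_complex :: "nat \<Rightarrow> nat set set \<Rightarrow> bool" where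
  "simplicial_complex m K \<longleftrightarrow> K \<noteq> {} \<and> (\<forall>\<sigma>\<in>K. \<sigma> \<subseteq> {1..m}) \<and>
     (\<forall>\<sigma>\<in>K. \<forall>\<tau>. \<tau> \<subseteq> \<sigma> \<longrightarrow> \<tau> \<in> K) \<and> (\<forall>i\<in>{1..m}. {i} \<in> K)"

definition polyhedral_product_set ::
  "nat \<Rightarrow> nat set set \<Rightarrow> (nat \<Rightarrow> 'a topology) \<Rightarrow> (nat \<Rightarrow> 'a) \<Rightarrow> (nat \<Rightarrow> 'a) set" where
  "polyhedral_product_set m K T e =
     (\<Union>\<sigma>\<in>K. {x \<in> topspace (product_topology T {1..m}). \<forall>i\<in>{1..m} - \<sigma>. x i = e i})"

definition polyhedral_product ::
  "nat \<Rightarrow> nat set set \<Rightarrow> (nat \<Rightarrow> 'a topology) \<Rightarrow> (nat \<Rightarrow> 'a) \<Rightarrow> (nat \<Rightarrow> 'a) topology" where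
  "polyhedral_product m K T e =
     subtopology (product_topology T {1..m}) (polyhedral_product_set m K T e)"

end

theory Submission
  imports Defs
begin

text \<open>
Lower bound: given simplices \<open>\<sigma>1\<close>, \<open>\<sigma>2\<close>, send \<open>z\<close> in the product over \<open>\<sigma>1 \<union> \<sigma>2\<close> to the pair of
its restrictions to \<open>\<sigma>1\<close> and to \<open>\<sigma>2 - \<sigma>1\<close>. A motion planner at this pair moves the coordinates in
\<open>\<sigma>1\<close> to the neutral element and, run backwards, does the same for those in \<open>\<sigma>2 - \<sigma>1\<close>. So an open
cover with planners pulls back to a categorical cover of the product, and the LS-logarithmic
hypothesis turns this into the required inequality.

Upper bound: in a group, a path from \<open>x\<close> to \<open>y\<close> is obtained by contracting \<open>x y\<inverse>\<close> to the neutral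
element and multiplying by \<open>y\<close>. To stay inside the polyhedral product, each coordinate waits for a
time depending on how close \<open>x\<close> and \<open>y\<close> are to the neutral element: coordinates with \<open>x = 1\<close> do not
move before time 1/2, coordinates with \<open>y = 1\<close> do not move after it. Covers of the factors by
\<open>cat + 1\<close> positivity sets of continuous functions are merged into one cover of the square, indexed by
the sum over the coordinates of the number of the set containing \<open>x y\<inverse>\<close>; this number is 0 outside
the union of the two supports.

Continuous functions separating sets exist because a connected locally compact group is
sigma-compact, hence normal. A function vanishing at the neutral element only exists because a cell
of maximal dimension among those meeting a compact neighbourhood contains a nonempty open set, whose
points are zero sets; translation moves such a point to the neutral element.
\<close>

section \<open>Locally compact CW complexes\<close>

lemma cdisc_eq: "cdisc n = odisc n \<union> bsphere n"
  by (auto simp: cdisc_def odisc_def bsphere_def)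

text \<open>Tychonoff: the coordinates of a point of the disc have absolute value at most 1, so the
  disc lies in a product of compact intervals, and both defining conditions are closed in the
  product topology.\<close>

lemma compact_cdisc: "compact (cdisc n)"
proof -
  have "compactin (product_topology (\<lambda>_. euclidean) UNIV) (PiE UNIV (\<lambda>_::nat. {-1..1::real}))"
    by (subst compactin_PiE) auto
  then have box: "compact (PiE UNIV (\<lambda>_::nat. {-1..1::real}))"
    by (simp add: euclidean_product_topology)
  have *: "continuous_on UNIV (\<lambda>x::nat \<Rightarrow> real. x i)" for i
    by (rule continuous_on_product_coordinates)
  have "cdisc n = (\<Inter>i\<in>{n..}. {x. x i = 0}) \<inter> {x. (\<Sum>i<n. (x i)^2) \<le> 1}"
    by (auto simp: cdisc_def)
  moreover have "closed {x::nat \<Rightarrow> real. x i = 0}" for i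
    by (rule closed_Collect_eq) (auto intro: *)
  moreover have "closed {x::nat \<Rightarrow> real. (\<Sum>i<n. (x i)^2) \<le> 1}"
    by (rule closed_Collect_le) (auto intro!: continuous_intros *)
  ultimately have "closed (cdisc n)"
    by (metis closed_INT closed_Int)
  moreover have "cdisc n \<subseteq> PiE UNIV (\<lambda>_. {-1..1})"
  proof
    fix x assume x: "x \<in> cdisc n"
    have "\<bar>x i\<bar> \<le> 1" for i
    proof (cases "i < n")
      case True
      then have "(x i)^2 \<le> (\<Sum>i<n. (x i)^2)"
        by (intro member_le_sum) auto
      also have "\<dots> \<le> 1"
        using x by (simp add: cdisc_def)
      finally show ?thesis
        by (simp add: abs_square_le_1)
    next
      case False
      then show ?thesis using x by (simp add: cdisc_def)
    qed
    then show "x \<in> PiE UNIV (\<lambda>_. {-1..1})"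
      by (auto simp: abs_le_iff minus_le_iff)
  qed
  ultimately show ?thesis
    using box compact_Int_closed by (metis inf.absorb_iff2)
qed

text \<open>The disc is star-shaped about the origin.\<close>

lemma path_connected_cdisc: "path_connected (cdisc n)"
proof -
  have *: "path_component (cdisc n) (\<lambda>_. 0) x" if x: "x \<in> cdisc n" for x
    unfolding path_component_def
  proof (intro exI conjI)
    let ?g = "\<lambda>t::real. (\<lambda>i. t * x i)"
    show "path ?g"
      unfolding path_def by (intro continuous_on_coordinatewise_then_product continuous_intros)
    show "path_image ?g \<subseteq> cdisc n"
    proof (clarsimp simp: path_image_def)
      fix t :: real assume t: "0 \<le> t" "t \<le> 1"
      have "(\<Sum>i<n. (t * x i)^2) = t^2 * (\<Sum>i<n. (x i)^2)"
        by (simp add: power_mult_distrib sum_distrib_left)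
      also have "\<dots> \<le> 1 * 1"
        using x t by (intro mult_mono) (auto simp: cdisc_def sum_nonneg power_le_one)
      finally show "?g t \<in> cdisc n"
        using x by (auto simp: cdisc_def)
    qed
  qed (auto simp: pathstart_def pathfinish_def)
  show ?thesis
    unfolding path_connected_component
    using * by (metis path_component_sym path_component_trans)
qed

section \<open>Spaces with a fixed choice of characteristic maps\<close>

locale cell_structure =
  fixes X :: "'a topology" and C :: "(nat \<times> ((nat \<Rightarrow> real) \<Rightarrow> 'a)) set"
  assumes Hausdorff: "Hausdorff_space X"
    and continuous_cell: "(n, \<phi>) \<in> C \<Longrightarrow> continuous_map (top_of_set (cdisc n)) X \<phi>"
    and homeomorphic_cell: "(n, \<phi>) \<in> C \<Longrightarrow>
      homeomorphic_map (top_of_set (odisc n)) (subtopology X (\<phi> ` odisc n)) \<phi>"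
    and disjoint_cells: "\<lbrakk>(n, \<phi>) \<in> C; (k, \<psi>) \<in> C; (n, \<phi>) \<noteq> (k, \<psi>)\<rbrakk> \<Longrightarrow>
      \<phi> ` odisc n \<inter> \<psi> ` odisc k = {}"
    and cells_cover: "x \<in> topspace X \<Longrightarrow> \<exists>n \<phi>. (n, \<phi>) \<in> C \<and> x \<in> \<phi> ` odisc n"
    and closure_finite: "(n, \<phi>) \<in> C \<Longrightarrow> \<exists>F\<subseteq>C. finite F \<and> (\<forall>(k, \<psi>)\<in>F. k < n) \<and>
          \<phi> ` bsphere n \<subseteq> (\<Union>(k, \<psi>)\<in>F. \<psi> ` odisc k)"
    and weak_topology: "\<lbrakk>A \<subseteq> topspace X; \<And>n \<phi>. (n, \<phi>) \<in> C \<Longrightarrow> closedin X (A \<inter> \<phi> ` cdisc n)\<rbrakk>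
      \<Longrightarrow> closedin X A"

lemma cw_complexE:
  assumes "cw_complex X"
  obtains C where "cell_structure X C"
proof -
  from assms obtain C :: "(nat \<times> ((nat \<Rightarrow> real) \<Rightarrow> 'a)) set" where H: "Hausdorff_space X"
    and 1: "\<forall>(n, \<phi>)\<in>C. continuous_map (subtopology euclidean (cdisc n)) X \<phi> \<and>
          homeomorphic_map (subtopology euclidean (odisc n)) (subtopology X (\<phi> ` odisc n)) \<phi>"
    and 2: "\<forall>c\<in>C. \<forall>d\<in>C. c \<noteq> d \<longrightarrow> snd c ` odisc (fst c) \<inter> snd d ` odisc (fst d) = {}"
    and 3: "(\<Union>(n, \<phi>)\<in>C. \<phi> ` odisc n) = topspace X"
    and 4: "\<forall>(n, \<phi>)\<in>C. \<exists>F\<subseteq>C. finite F \<and> (\<forall>(k, \<psi>)\<in>F. k < n) \<and>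
          \<phi> ` bsphere n \<subseteq> (\<Union>(k, \<psi>)\<in>F. \<psi> ` odisc k)"
    and 5: "\<forall>A\<subseteq>topspace X. closedin X A \<longleftrightarrow> (\<forall>(n, \<phi>)\<in>C. closedin X (A \<inter> \<phi> ` cdisc n))"
    unfolding cw_complex_def by (elim conjE exE) (rule that)
  have "cell_structure X C"
  proof
    show "\<phi> ` odisc n \<inter> \<psi> ` odisc k = {}"
      if "(n, \<phi>) \<in> C" "(k, \<psi>) \<in> C" "(n, \<phi>) \<noteq> (k, \<psi>)" for n \<phi> k \<psi>
      using bspec[OF bspec[OF 2 that(1)] that(2)] that(3) by simp
    show "\<exists>n \<phi>. (n, \<phi>) \<in> C \<and> x \<in> \<phi> ` odisc n" if "x \<in> topspace X" for x
      using that 3 by blast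
    show "closedin X A" if "A \<subseteq> topspace X" "\<And>n \<phi>. (n, \<phi>) \<in> C \<Longrightarrow> closedin X (A \<inter> \<phi> ` cdisc n)" for A
      using 5[rule_format, OF that(1)] that(2) by auto
    show "continuous_map (top_of_set (cdisc n)) X \<phi>" if "(n, \<phi>) \<in> C" for n \<phi>
      using bspec[OF 1 that] by simp
    show "homeomorphic_map (top_of_set (odisc n)) (subtopology X (\<phi> ` odisc n)) \<phi>"
      if "(n, \<phi>) \<in> C" for n \<phi>
      using bspec[OF 1 that] by simp
    show "\<exists>F\<subseteq>C. finite F \<and> (\<forall>(k, \<psi>)\<in>F. k < n) \<and> \<phi> ` bsphere n \<subseteq> (\<Union>(k, \<psi>)\<in>F. \<psi> ` odisc k)"
      if "(n, \<phi>) \<in> C" for n \<phi>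
      using bspec[OF 4 that] by simp
  qed (rule H)
  then show thesis by (rule that)
qed

context cell_structure
begin

lemma compactin_closed_cell: "(n, \<phi>) \<in> C \<Longrightarrow> compactin X (\<phi> ` cdisc n)"
  by (rule image_compactin[OF _ continuous_cell])
    (simp_all add: compactin_subtopology compact_cdisc)

lemma closedin_closed_cell: "(n, \<phi>) \<in> C \<Longrightarrow> closedin X (\<phi> ` cdisc n)"
  by (simp add: compactin_closed_cell Hausdorff compactin_imp_closedin)

text \<open>Closed cells are path-connected, so a union of path components contains each of them or
  misses it, and is therefore closed by the weak topology. Applied to a path component and to its
  complement, this makes the component clopen.\<close>

lemma path_connected_if_connected:
  assumes "connected_space X"
  shows "path_connected_space X"
proof -
  have cell: "path_connectedin X (\<phi> ` cdisc n)" if "(n, \<phi>) \<in> C" for n \<phi>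
    by (rule path_connectedin_continuous_map_image[OF continuous_cell[OF that]])
      (simp add: path_connectedin_subtopology path_connected_cdisc)
  have clo: "closedin X A" if A: "A \<subseteq> topspace X"
    and sat: "\<And>x y. x \<in> A \<Longrightarrow> path_component_of X x y \<Longrightarrow> y \<in> A" for A
  proof (rule weak_topology[OF A])
    fix n \<phi> assume c: "(n, \<phi>) \<in> C"
    have "\<phi> ` cdisc n \<subseteq> A" if "x \<in> A" "x \<in> \<phi> ` cdisc n" for x
    proof
      fix y assume "y \<in> \<phi> ` cdisc n"
      then have "path_component_of X x y"
        using path_component_of_maximal[OF cell[OF c] that(2)] by auto
      then show "y \<in> A" using sat that by blast
    qed
    then have "A \<inter> \<phi> ` cdisc n = {} \<or> A \<inter> \<phi> ` cdisc n = \<phi> ` cdisc n"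
      by blast
    then show "closedin X (A \<inter> \<phi> ` cdisc n)"
      using closedin_closed_cell[OF c] by fastforce
  qed
  have "path_component_of X x y" if "x \<in> topspace X" "y \<in> topspace X" for x y
  proof -
    let ?P = "Collect (path_component_of X x)"
    have P: "?P \<subseteq> topspace X"
      by (simp add: path_component_of_subset_topspace)
    have "closedin X ?P"
      by (rule clo[OF P]) (auto intro: path_component_of_trans)
    moreover have "closedin X (topspace X - ?P)"
    proof (rule clo)
      fix u v assume uv: "u \<in> topspace X - ?P" "path_component_of X u v"
      then have "v \<in> topspace X"
        using path_component_in_topspace by fastforce
      moreover have "\<not> path_component_of X x v"
        using uv by (metis DiffE mem_Collect_eq path_component_of_sym path_component_of_trans)
      ultimately show "v \<in> topspace X - ?P" by simp
    qed auto
    then have "openin X ?P"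
      using P by (simp add: openin_closedin_eq)
    ultimately have "?P = {} \<or> ?P = topspace X"
      using assms unfolding connected_space_clopen_in by blast
    moreover have "x \<in> ?P"
      using that(1) by (simp add: path_component_of_refl)
    ultimately show ?thesis
      using that(2) by auto
  qed
  then show ?thesis
    by (simp add: path_connected_space_iff_path_component)
qed

lemma closed_cell_subset:
  assumes c: "(n, \<phi>) \<in> C"
  obtains F where "F \<subseteq> C" "finite F" "\<And>k \<psi>. (k, \<psi>) \<in> F \<Longrightarrow> k < n"
    "\<phi> ` cdisc n \<subseteq> \<phi> ` odisc n \<union> (\<Union>(k, \<psi>)\<in>F. \<psi> ` odisc k)"
proof -
  obtain F where F: "F \<subseteq> C" "finite F" "\<forall>(k, \<psi>)\<in>F. k < n"
    "\<phi> ` bsphere n \<subseteq> (\<Union>(k, \<psi>)\<in>F. \<psi> ` odisc k)"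
    using closure_finite[OF c] by blast
  moreover have "\<phi> ` cdisc n = \<phi> ` odisc n \<union> \<phi> ` bsphere n"
    by (simp add: cdisc_eq image_Un)
  ultimately show thesis
    by (intro that[of F]) auto
qed

text \<open>Choose a point of \<open>L\<close> in each cell that meets \<open>L\<close>. By closure
  finiteness a closed cell contains only finitely many of these points, so every set of them is
  closed. If there were infinitely many, compactness would give an accumulation point.\<close>

lemma compactin_meets_finitely_many_cells:
  assumes "compactin X L"
  shows "finite {(n, \<phi>) \<in> C. \<phi> ` odisc n \<inter> L \<noteq> {}}"
proof (rule ccontr)
  let ?M = "{(n, \<phi>) \<in> C. \<phi> ` odisc n \<inter> L \<noteq> {}}"
  assume inf: "infinite ?M"
  have "\<forall>c\<in>?M. \<exists>x. x \<in> snd c ` odisc (fst c) \<inter> L"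
    by auto
  from bchoice[OF this] obtain p where p: "\<And>c. c \<in> ?M \<Longrightarrow> p c \<in> snd c ` odisc (fst c) \<inter> L"
    by blast
  have inj: "inj_on p ?M"
  proof (rule inj_onI)
    fix c d assume cd: "c \<in> ?M" "d \<in> ?M" "p c = p d"
    then have "snd c ` odisc (fst c) \<inter> snd d ` odisc (fst d) \<noteq> {}"
      using p[of c] p[of d] by auto
    then show "c = d"
      using cd disjoint_cells[of "fst c" "snd c" "fst d" "snd d"] by auto
  qed
  have Ltop: "L \<subseteq> topspace X"
    using assms compactin_subset_topspace by blast
  have clo: "closedin X S" if S: "S \<subseteq> p ` ?M" for S
  proof (rule weak_topology)
    show "S \<subseteq> topspace X"
      using S p Ltop by blast
    fix n \<phi> assume c: "(n, \<phi>) \<in> C"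
    obtain F where F: "F \<subseteq> C" "finite F"
      "\<phi> ` cdisc n \<subseteq> \<phi> ` odisc n \<union> (\<Union>(k, \<psi>)\<in>F. \<psi> ` odisc k)"
      using closed_cell_subset[OF c] by metis
    have "S \<inter> \<phi> ` cdisc n \<subseteq> p ` insert (n, \<phi>) F"
    proof
      fix x assume x: "x \<in> S \<inter> \<phi> ` cdisc n"
      then obtain d where d: "d \<in> ?M" "x = p d"
        using S by blast
      obtain b where b: "b \<in> insert (n, \<phi>) F" "x \<in> snd b ` odisc (fst b)"
      proof (cases "x \<in> \<phi> ` odisc n")
        case True
        then show thesis by (intro that[of "(n, \<phi>)"]) auto
      next
        case False
        then have "x \<in> (\<Union>(k, \<psi>)\<in>F. \<psi> ` odisc k)"
          using x F(3) by blast
        then obtain k \<psi> where "(k, \<psi>) \<in> F" "x \<in> \<psi> ` odisc k"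
          by blast
        then show thesis by (intro that[of "(k, \<psi>)"]) auto
      qed
      have "b \<in> C" using b F(1) c by auto
      moreover have "x \<in> snd d ` odisc (fst d)"
        using p[OF d(1)] d(2) by auto
      ultimately have "b = d"
        using disjoint_cells[of "fst b" "snd b" "fst d" "snd d"] b d by auto
      then show "x \<in> p ` insert (n, \<phi>) F"
        using b d by blast
    qed
    then have "finite (S \<inter> \<phi> ` cdisc n)"
      using F(2) finite_subset by blast
    then show "closedin X (S \<inter> \<phi> ` cdisc n)"
      using \<open>S \<subseteq> topspace X\<close> Hausdorff
      by (meson Hausdorff_imp_t1_space Int_lower1 order_trans t1_space_closedin_finite)
  qed
  have "infinite (p ` ?M)"
    using inf inj finite_imageD by blast
  moreover have "p ` ?M \<subseteq> L"
    using p by blast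
  ultimately obtain x where x: "x \<in> X derived_set_of (p ` ?M)"
    using compactin_imp_Bolzano_Weierstrass[OF assms] by blast
  define S where "S = p ` ?M"
  \<comment> \<open>This neighbourhood of the accumulation point \<open>x\<close> contains no other
    chosen point.\<close>
  have "openin X (topspace X - (S - {x}))"
    using clo[of "S - {x}"] unfolding S_def by blast
  moreover have "x \<in> topspace X" and *: "\<And>T. x \<in> T \<Longrightarrow> openin X T \<Longrightarrow> \<exists>y\<noteq>x. y \<in> S \<and> y \<in> T"
    using x unfolding in_derived_set_of S_def by simp_all
  ultimately show False
    using *[of "topspace X - (S - {x})"] by blast
qed

text \<open>A neighbourhood inside a compact set meets finitely many cells. Pick one of greatest
  dimension among them and remove the closures of all the others.\<close>

lemma ex_open_in_cell:
  assumes lc: "locally_compact_space X" and ne: "topspace X \<noteq> {}"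
  obtains n \<phi> W where "(n, \<phi>) \<in> C" "openin X W" "W \<noteq> {}" "W \<subseteq> \<phi> ` odisc n"
proof -
  obtain q where q: "q \<in> topspace X" using ne by blast
  obtain U L where UL: "openin X U" "compactin X L" "q \<in> U" "U \<subseteq> L"
    using lc q unfolding locally_compact_space_def by blast
  let ?M = "{(n, \<phi>) \<in> C. \<phi> ` odisc n \<inter> U \<noteq> {}}"
  have fin: "finite ?M"
    by (rule finite_subset[OF _ compactin_meets_finitely_many_cells[OF UL(2)]]) (use UL(4) in auto)
  have "?M \<noteq> {}"
    using cells_cover[OF q] UL(3) by auto
  then have "Max (fst ` ?M) \<in> fst ` ?M"
    using fin by (intro Max_in) auto
  then obtain n \<phi> where c: "(n, \<phi>) \<in> ?M" and n: "n = Max (fst ` ?M)"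
    by force
  have le: "k \<le> n" if "(k, \<psi>) \<in> ?M" for k \<psi>
    unfolding n using that fin by (intro Max_ge) force+
  define W where "W = U - (\<Union>(k, \<psi>)\<in>?M - {(n, \<phi>)}. \<psi> ` cdisc k)"
  have "closedin X (\<Union>(k, \<psi>)\<in>?M - {(n, \<phi>)}. \<psi> ` cdisc k)"
    using fin by (intro closedin_Union) (auto intro: closedin_closed_cell)
  then have "openin X W"
    unfolding W_def using UL(1) by (rule openin_diff[rotated])
  moreover have "W \<subseteq> \<phi> ` odisc n"
  proof
    fix x assume x: "x \<in> W"
    then have xU: "x \<in> U" by (simp add: W_def)
    then obtain k \<psi> where k: "(k, \<psi>) \<in> C" "x \<in> \<psi> ` odisc k"
      using cells_cover UL(1) openin_subset by blast
    then have kM: "(k, \<psi>) \<in> ?M"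
      using xU by auto
    have "x \<in> \<psi> ` cdisc k"
      using k(2) cdisc_eq by blast
    then have "(k, \<psi>) = (n, \<phi>)"
      using x kM unfolding W_def by blast
    then show "x \<in> \<phi> ` odisc n" using k by auto
  qed
  moreover have "W \<noteq> {}"
  proof -
    obtain x where x: "x \<in> \<phi> ` odisc n" "x \<in> U"
      using c by auto
    \<comment> \<open>Another closed cell is covered by its open cell, which is disjoint from the
      chosen one, and by cells of dimension below \<open>k \<le> n\<close>, which differ from the
      chosen one.\<close>
    have "x \<notin> \<psi> ` cdisc k" if k: "(k, \<psi>) \<in> ?M - {(n, \<phi>)}" for k \<psi>
    proof
      assume xk: "x \<in> \<psi> ` cdisc k"
      have kC: "(k, \<psi>) \<in> C" using k by auto
      obtain F where F: "F \<subseteq> C" "\<And>j \<theta>. (j, \<theta>) \<in> F \<Longrightarrow> j < k"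
        "\<psi> ` cdisc k \<subseteq> \<psi> ` odisc k \<union> (\<Union>(j, \<theta>)\<in>F. \<theta> ` odisc j)"
        using closed_cell_subset[OF kC] by metis
      have "x \<notin> \<psi> ` odisc k"
        using disjoint_cells[OF kC, of n \<phi>] c k x by auto
      then obtain j \<theta> where j: "(j, \<theta>) \<in> F" "x \<in> \<theta> ` odisc j"
        using xk F(3) by blast
      have "j < n" using F(2)[OF j(1)] le[of k \<psi>] k by auto
      then show False
        using disjoint_cells[of j \<theta> n \<phi>] j F(1) c x by auto
    qed
    then show ?thesis
      unfolding W_def using x by blast
  qed
  ultimately show thesis
    using that c by blast
qed

text \<open>On an open set \<open>W\<close> inside a cell, the chart measures the distance to a
  point \<open>p\<close> of \<open>W\<close>. Complete regularity gives a function \<open>g\<close>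
  that is 0 at \<open>p\<close> and 1 off \<open>W\<close>; adding it allows an extension by the
  constant 1.\<close>

lemma ex_zero_set_point:
  assumes lc: "locally_compact_space X" and ne: "topspace X \<noteq> {}"
  obtains p \<delta> where "p \<in> topspace X" "continuous_map X euclideanreal \<delta>"
    "\<And>x. x \<in> topspace X \<Longrightarrow> 0 \<le> \<delta> x \<and> \<delta> x \<le> 1"
    "\<And>x. x \<in> topspace X \<Longrightarrow> \<delta> x = 0 \<longleftrightarrow> x = p"
proof -
  obtain n \<phi> W where c: "(n, \<phi>) \<in> C" and W: "openin X W" "W \<noteq> {}" "W \<subseteq> \<phi> ` odisc n"
    by (rule ex_open_in_cell[OF assms])
  obtain p where p: "p \<in> W" using W by blast
  have Wtop: "W \<subseteq> topspace X" using W openin_subset by blast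
  obtain \<psi> where \<psi>: "homeomorphic_maps (top_of_set (odisc n)) (subtopology X (\<phi> ` odisc n)) \<phi> \<psi>"
    using homeomorphic_cell[OF c] homeomorphic_map_maps by blast
  have cont\<psi>: "continuous_map (subtopology X W) euclidean \<psi>"
    using \<psi> W(3) unfolding homeomorphic_maps_def
    by (meson continuous_map_from_subtopology_mono continuous_map_into_fulltopology)
  have "\<phi> (\<psi> x) = x" if "x \<in> W" for x
  proof -
    have "x \<in> topspace (subtopology X (\<phi> ` odisc n))"
      using that W(3) Wtop by auto
    then show ?thesis
      using \<psi> unfolding homeomorphic_maps_def by blast
  qed
  then have inj: "x = y" if "x \<in> W" "y \<in> W" "\<psi> x = \<psi> y" for x y
    using that by metis
  have "completely_regular_space X"
    using lc Hausdorff by (simp add: locally_compact_regular_imp_completely_regular_space)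
  moreover have "closedin X (topspace X - W)" "p \<in> topspace X - (topspace X - W)"
    using W p Wtop by auto
  ultimately obtain g :: "'a \<Rightarrow> real" where g: "continuous_map X (top_of_set {0..1}) g"
    "g p = 0" "g ` (topspace X - W) \<subseteq> {1}"
    unfolding completely_regular_space_def by blast
  have gr: "continuous_map X euclideanreal g"
    using g(1) continuous_map_into_fulltopology by blast
  have g01: "0 \<le> g x" "g x \<le> 1" if "x \<in> topspace X" for x
    using g(1) that by (auto simp: continuous_map_def)
  \<comment> \<open>The factor 2 makes the first branch equal to 1 wherever \<open>g > 1/2\<close>.
    That open set contains the complement of \<open>W\<close>, so the two branches agree on the
    overlap of two open sets covering the space.\<close>
  define \<delta> where "\<delta> x = (if x \<in> W then min 1 (2 * g x + dist (\<psi> x) (\<psi> p)) else 1)" for x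
  have dist: "continuous_map (subtopology X W) euclideanreal (\<lambda>x. dist (\<psi> x) (\<psi> p))"
  proof -
    have "continuous_map euclidean euclideanreal (\<lambda>z. dist z (\<psi> p))"
      by (simp add: continuous_on_dist)
    from continuous_map_compose[OF cont\<psi> this] show ?thesis
      by (simp add: o_def)
  qed
  let ?V = "{x \<in> topspace X. g x \<in> {1/2<..}}"
  have V: "openin X ?V"
    by (rule openin_continuous_map_preimage[OF gr]) auto
  have "continuous_map X euclideanreal \<delta>"
  proof (rule pasting_lemma[where I = "{True, False}" and T = "\<lambda>b. if b then W else ?V"
        and f = "\<lambda>b x. if b then min 1 (2 * g x + dist (\<psi> x) (\<psi> p)) else 1"])
    fix b assume "b \<in> {True, False}"
    have "continuous_map (subtopology X W) euclideanreal (\<lambda>x. min 1 (2 * g x + dist (\<psi> x) (\<psi> p)))"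
      by (intro continuous_intros dist continuous_map_from_subtopology[OF gr])
    then show "continuous_map (subtopology X (if b then W else ?V)) euclideanreal
        (\<lambda>x. if b then min 1 (2 * g x + dist (\<psi> x) (\<psi> p)) else 1)"
      by (cases b) auto
  next
    fix x assume x: "x \<in> topspace X"
    show "\<exists>b. b \<in> {True, False} \<and> x \<in> (if b then W else ?V) \<and>
        \<delta> x = (if b then min 1 (2 * g x + dist (\<psi> x) (\<psi> p)) else 1)"
    proof (cases "x \<in> W")
      case True then show ?thesis by (intro exI[of _ True]) (simp add: \<delta>_def)
    next
      case False
      then have "g x = 1" using g(3) x by auto
      then show ?thesis using False x by (intro exI[of _ False]) (simp add: \<delta>_def)
    qed
  next
    fix b b' x
    assume "x \<in> topspace X \<inter> (if b then W else ?V) \<inter> (if b' then W else ?V)"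
    moreover have "min 1 (2 * g x + dist (\<psi> x) (\<psi> p)) = 1" if "x \<in> ?V"
    proof -
      have "1 \<le> 2 * g x" using that by auto
      then show ?thesis
        using zero_le_dist[of "\<psi> x" "\<psi> p"] by linarith
    qed
    ultimately show "(if b then min 1 (2 * g x + dist (\<psi> x) (\<psi> p)) else 1) =
        (if b' then min 1 (2 * g x + dist (\<psi> x) (\<psi> p)) else 1)"
      by (cases b; cases b') auto
  qed (use W V in auto)
  moreover have "0 \<le> \<delta> x \<and> \<delta> x \<le> 1" if "x \<in> topspace X" for x
    using g01[OF that] by (auto simp: \<delta>_def)
  moreover have "\<delta> x = 0 \<longleftrightarrow> x = p" if x: "x \<in> topspace X" for x
  proof
    assume "\<delta> x = 0"
    then have xW: "x \<in> W" and "min 1 (2 * g x + dist (\<psi> x) (\<psi> p)) = 0"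
      unfolding \<delta>_def by (auto split: if_splits)
    then have "dist (\<psi> x) (\<psi> p) = 0"
      using g01[OF x] zero_le_dist[of "\<psi> x" "\<psi> p"] by linarith
    then show "x = p" using inj xW p by auto
  qed (use g(2) p in \<open>simp add: \<delta>_def\<close>)
  moreover have "p \<in> topspace X" using p Wtop by blast
  ultimately show thesis
    using that by blast
qed

end

section \<open>Locally compact connected topological groups\<close>

locale top_group = group G for G (structure) +
  fixes T :: "'a topology"
  assumes topological_group: "topological_group G T"
begin

lemma carrier_eq: "carrier G = topspace T"
  using topological_group by (simp add: topological_group_def)

lemma continuous_map_mult:
  assumes "continuous_map Z T f" "continuous_map Z T g"
  shows "continuous_map Z T (\<lambda>z. f z \<otimes> g z)"
proof -
  have "continuous_map (prod_topology T T) T (\<lambda>(x, y). x \<otimes> y)"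
    using topological_group by (simp add: topological_group_def)
  from continuous_map_compose[OF continuous_map_pairedI[OF assms] this] show ?thesis
    by (simp add: o_def)
qed

lemma continuous_map_inv:
  assumes "continuous_map Z T f"
  shows "continuous_map Z T (\<lambda>z. inv (f z))"
proof -
  have "continuous_map T T (\<lambda>x. inv x)"
    using topological_group by (simp add: topological_group_def)
  from continuous_map_compose[OF assms this] show ?thesis
    by (simp add: o_def)
qed

lemma one_in_topspace: "\<one> \<in> topspace T"
  using one_closed carrier_eq by blast

text \<open>The powers of a compact neighbourhood of \<^term>\<open>\<one>\<close> exhaust a clopen subset, hence everything.\<close>

lemma Lindelof_space:
  assumes lc: "locally_compact_space T" and conn: "connected_space T"
  shows "Lindelof_space T"
proof -
  obtain U L where UL: "openin T U" "compactin T L" "\<one> \<in> U" "U \<subseteq> L"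
    using lc one_in_topspace unfolding locally_compact_space_def by blast
  \<comment> \<open>\<open>P n\<close> consists of the products of \<open>n + 1\<close> elements of
    \<open>L\<close>.\<close>
  define P where "P n = ((\<lambda>M. (\<lambda>(x, y). x \<otimes> y) ` (M \<times> L)) ^^ n) L" for n
  have PSuc: "P (Suc n) = (\<lambda>(x, y). x \<otimes> y) ` (P n \<times> L)" for n
    by (simp add: P_def)
  have Pc: "compactin T (P n)" for n
  proof (induction n)
    case 0
    then show ?case using UL(2) by (simp add: P_def)
  next
    case (Suc n)
    have "continuous_map (prod_topology T T) T (\<lambda>(x, y). x \<otimes> y)"
      using topological_group by (simp add: topological_group_def)
    moreover have "compactin (prod_topology T T) (P n \<times> L)"
      using Suc UL(2) by (simp add: compactin_Times)
    ultimately show ?case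
      unfolding PSuc by (rule image_compactin[rotated])
  qed
  have Ptop: "P n \<subseteq> topspace T" for n
    using Pc compactin_subset_topspace by blast
  have Ltop: "L \<subseteq> topspace T" and Utop: "U \<subseteq> topspace T"
    using UL(2,4) compactin_subset_topspace by blast+
  let ?Q = "\<Union>n. P n"
  have step: "x \<otimes> u \<in> ?Q" if x: "x \<in> ?Q" and u: "u \<in> U" for x u
  proof -
    obtain n where "x \<in> P n" using x by blast
    then have "x \<otimes> u \<in> P (Suc n)"
      unfolding PSuc using u UL(4) by force
    then show ?thesis by blast
  qed
  have "openin T ?Q"
  proof (subst openin_subopen, intro ballI)
    fix x assume x: "x \<in> ?Q"
    then have xt: "x \<in> topspace T" using Ptop by blast
    let ?N = "{y \<in> topspace T. inv x \<otimes> y \<in> U}"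
    have "openin T ?N"
      by (rule openin_continuous_map_preimage[OF _ UL(1)])
        (use xt inv_closed[of x] carrier_eq in \<open>auto intro!: continuous_map_mult\<close>)
    moreover have "x \<in> ?N"
      using xt UL(3) carrier_eq l_inv by simp
    moreover have "?N \<subseteq> ?Q"
    proof
      fix y assume y: "y \<in> ?N"
      then have "x \<otimes> (inv x \<otimes> y) \<in> ?Q"
        using step[OF x, of "inv x \<otimes> y"] by simp
      moreover have "x \<otimes> (inv x \<otimes> y) = y"
        using xt y unfolding carrier_eq[symmetric] by (simp add: m_assoc[symmetric])
      ultimately show "y \<in> ?Q" by simp
    qed
    ultimately show "\<exists>N. openin T N \<and> x \<in> N \<and> N \<subseteq> ?Q" by blast
  qed
  moreover have "openin T (topspace T - ?Q)"
  proof (subst openin_subopen, intro ballI)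
    fix x assume x: "x \<in> topspace T - ?Q"
    \<comment> \<open>If such a \<open>y\<close> lay in \<open>?Q\<close>, then so would
      \<open>x = y \<otimes> (inv y \<otimes> x)\<close>, by \<open>step\<close>.\<close>
    let ?N = "{y \<in> topspace T. inv y \<otimes> x \<in> U}"
    have "openin T ?N"
      by (rule openin_continuous_map_preimage[OF _ UL(1)])
        (use x in \<open>auto intro!: continuous_map_mult continuous_map_inv[where f = "\<lambda>x. x"]\<close>)
    moreover have "x \<in> ?N"
      using x UL(3) carrier_eq l_inv by simp
    moreover have "?N \<subseteq> topspace T - ?Q"
    proof
      fix y assume y: "y \<in> ?N"
      have "y \<notin> ?Q"
      proof
        assume "y \<in> ?Q"
        then have "y \<otimes> (inv y \<otimes> x) \<in> ?Q"
          using step[of y "inv y \<otimes> x"] y by simp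
        moreover have "y \<otimes> (inv y \<otimes> x) = x"
          using x y unfolding carrier_eq[symmetric] by (simp add: m_assoc[symmetric])
        ultimately show False using x by simp
      qed
      then show "y \<in> topspace T - ?Q" using y by simp
    qed
    ultimately show "\<exists>N. openin T N \<and> x \<in> N \<and> N \<subseteq> topspace T - ?Q" by blast
  qed
  ultimately have "?Q = {} \<or> ?Q = topspace T"
    using conn Ptop unfolding connected_space_clopen_in closedin_def by blast
  moreover have "\<one> \<in> P 0"
    using UL(3,4) by (auto simp: P_def)
  ultimately have Q: "?Q = topspace T" by blast
  have "Lindelof_space (subtopology T (\<Union>(range P)))"
  proof (rule Lindelof_space_Union)
    show "Lindelof_space (subtopology T S)" if "S \<in> range P" for S
      using that Pc by (auto intro: compact_imp_Lindelof_space simp: compact_space_subtopology)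
  qed auto
  then show ?thesis
    using Q by simp
qed

lemma ex_zero_set_one:
  assumes "cw_complex T" and lc: "locally_compact_space T"
  obtains d where "continuous_map T euclideanreal d"
    "\<And>x. x \<in> topspace T \<Longrightarrow> 0 \<le> d x \<and> d x \<le> 1"
    "\<And>x. x \<in> topspace T \<Longrightarrow> d x = 0 \<longleftrightarrow> x = \<one>"
proof -
  obtain C where "cell_structure T C"
    using cw_complexE[OF assms(1)] .
  moreover have "topspace T \<noteq> {}"
    using one_in_topspace by blast
  ultimately obtain p \<delta> where p: "p \<in> topspace T" and \<delta>: "continuous_map T euclideanreal \<delta>"
    "\<And>x. x \<in> topspace T \<Longrightarrow> 0 \<le> \<delta> x \<and> \<delta> x \<le> 1"
    "\<And>x. x \<in> topspace T \<Longrightarrow> \<delta> x = 0 \<longleftrightarrow> x = p"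
    using cell_structure.ex_zero_set_point[OF _ lc] by metis
  have px: "p \<otimes> x \<in> topspace T" if "x \<in> topspace T" for x
    using p that carrier_eq by blast
  show thesis
  proof
    show "continuous_map T euclideanreal (\<lambda>x. \<delta> (p \<otimes> x))"
      by (rule continuous_map_compose[OF _ \<delta>(1), unfolded o_def])
        (use p in \<open>auto intro!: continuous_map_mult\<close>)
    show "\<delta> (p \<otimes> x) = 0 \<longleftrightarrow> x = \<one>" if "x \<in> topspace T" for x
      using \<delta>(3)[OF px[OF that]] that p carrier_eq by simp
  qed (use \<delta>(2) px in auto)
qed

end

section \<open>Positivity sets in normal spaces and reparametrized homotopies\<close>

text \<open>The sets of an open cover are shrunk to positivity sets one at a time. The open set
  \<open>R\<close> makes the induction work: it collects the sets that are still to be shrunk, and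
  is empty in the application.\<close>

lemma normal_space_cozero_shrinking:
  assumes "normal_space X" "finite J" "\<And>j. j \<in> J \<Longrightarrow> openin X (V j)" "openin X R"
    and "topspace X \<subseteq> R \<union> (\<Union>j\<in>J. V j)"
  shows "\<exists>f :: 'i \<Rightarrow> 'a \<Rightarrow> real.
    (\<forall>j\<in>J. continuous_map X euclideanreal (f j) \<and> (\<forall>x\<in>topspace X. 0 \<le> f j x \<and> (f j x > 0 \<longrightarrow> x \<in> V j))) \<and>
    (\<forall>x\<in>topspace X - R. \<exists>j\<in>J. f j x > 0)"
  using assms(2-)
proof (induction J arbitrary: R rule: finite_induct)
  case empty
  then show ?case by auto
next
  case (insert a J)
  have "\<exists>f :: 'i \<Rightarrow> 'a \<Rightarrow> real.
    (\<forall>j\<in>J. continuous_map X euclideanreal (f j) \<and> (\<forall>x\<in>topspace X. 0 \<le> f j x \<and> (f j x > 0 \<longrightarrow> x \<in> V j))) \<and>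
    (\<forall>x\<in>topspace X - (R \<union> V a). \<exists>j\<in>J. f j x > 0)"
    by (rule insert.IH) (use insert.prems in auto)
  then obtain f :: "'i \<Rightarrow> 'a \<Rightarrow> real" where
      f: "\<And>j. j \<in> J \<Longrightarrow> continuous_map X euclideanreal (f j)"
        "\<And>j x. j \<in> J \<Longrightarrow> x \<in> topspace X \<Longrightarrow> 0 \<le> f j x \<and> (f j x > 0 \<longrightarrow> x \<in> V j)"
    and cov: "\<And>x. x \<in> topspace X - (R \<union> V a) \<Longrightarrow> \<exists>j\<in>J. f j x > 0"
    by blast
  let ?Q = "R \<union> (\<Union>j\<in>J. {x \<in> topspace X. f j x \<in> {0<..}})"
  have "openin X {x \<in> topspace X. f j x \<in> {0<..}}" if "j \<in> J" for j
    by (rule openin_continuous_map_preimage[OF f(1)[OF that]]) auto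
  then have "openin X ?Q"
    using insert.prems(2) by (intro openin_Un openin_Union) auto
  then have clo: "closedin X (topspace X - ?Q)" "closedin X (topspace X - V a)"
    using insert.prems(1) by auto
  have "disjnt (topspace X - V a) (topspace X - ?Q)"
    unfolding disjnt_iff using cov by fastforce
  \<comment> \<open>What the other functions and \<open>R\<close> leave uncovered is a closed subset
    of \<open>V a\<close>, so Urysohn's lemma applies to it and the complement of
    \<open>V a\<close>.\<close>
  then obtain g :: "'a \<Rightarrow> real" where g: "continuous_map X (top_of_set {0..1}) g"
    "g ` (topspace X - V a) \<subseteq> {0}" "g ` (topspace X - ?Q) \<subseteq> {1}"
    using Urysohn_lemma[OF assms(1) clo(2) clo(1), of 0 1] by auto
  have g01: "0 \<le> g x" if "x \<in> topspace X" for x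
    using g(1) that by (auto simp: continuous_map_def)
  have gV: "x \<in> V a" if "x \<in> topspace X" "g x > 0" for x
    using g(2) that by fastforce
  show ?case
  proof (intro exI[of _ "f(a := g)"] conjI ballI)
    fix j assume j: "j \<in> insert a J"
    show "continuous_map X euclideanreal ((f(a := g)) j)"
      using j f(1) g(1) continuous_map_into_fulltopology by auto
    show "0 \<le> (f(a := g)) j x" "(f(a := g)) j x > 0 \<longrightarrow> x \<in> V j" if "x \<in> topspace X" for x
      using j f(2) that g01 gV by auto
  next
    fix x assume x: "x \<in> topspace X - R"
    show "\<exists>j\<in>insert a J. (f(a := g)) j x > 0"
    proof (cases "x \<in> ?Q")
      case True
      then obtain j where "j \<in> J" "f j x > 0" using x by auto
      then show ?thesis using insert.hyps by auto
    next
      case False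
      then have "g x = 1" using x g(3) by auto
      then show ?thesis by (intro bexI[of _ a]) auto
    qed
  qed
qed

text \<open>At the points where \<^term>\<open>s\<close> is discontinuous the homotopy is stationary, so by
compactness of the interval the time parameter does not matter there.\<close>

lemma continuous_map_homotopy_reparametrized:
  fixes s :: "'c \<Rightarrow> real"
  assumes h: "continuous_map (prod_topology (top_of_set {0..1}) Y) W h"
    and q: "continuous_map Z Y q"
    and s01: "\<And>z. z \<in> topspace Z \<Longrightarrow> s z \<in> {0..1}"
    and D: "openin Z D" "continuous_map (subtopology Z D) euclideanreal s"
    and const: "\<And>z t. z \<in> topspace Z - D \<Longrightarrow> t \<in> {0..1} \<Longrightarrow> h (t, q z) = w z"
  shows "continuous_map Z W (\<lambda>z. h (s z, q z))"
  unfolding continuous_map_def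
proof (intro conjI allI impI)
  have qY: "q z \<in> topspace Y" if "z \<in> topspace Z" for z
    using q that by (auto simp: continuous_map_def)
  show "(\<lambda>z. h (s z, q z)) \<in> topspace Z \<rightarrow> topspace W"
    using h s01 qY by (fastforce simp: continuous_map_def)
  fix N assume N: "openin W N"
  let ?A = "{z \<in> topspace Z. h (s z, q z) \<in> N}"
  have contD: "continuous_map (subtopology Z D) W (\<lambda>z. h (s z, q z))"
  proof -
    have "continuous_map (subtopology Z D) (prod_topology (top_of_set {0..1}) Y) (\<lambda>z. (s z, q z))"
      by (intro continuous_map_pairedI continuous_map_from_subtopology[OF q])
        (use D s01 in \<open>auto simp: continuous_map_in_subtopology\<close>)
    from continuous_map_compose[OF this h] show ?thesis by (simp add: o_def)
  qed
  show "openin Z ?A"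
  proof (subst openin_subopen, intro ballI)
    fix z assume z: "z \<in> ?A"
    show "\<exists>M. openin Z M \<and> z \<in> M \<and> M \<subseteq> ?A"
    proof (cases "z \<in> D")
      case True
      have "openin (subtopology Z D) {x \<in> topspace (subtopology Z D). h (s x, q x) \<in> N}"
        by (rule openin_continuous_map_preimage[OF contD N])
      then have "openin Z {x \<in> topspace (subtopology Z D). h (s x, q x) \<in> N}"
        using D(1) openin_trans_full by blast
      moreover have "z \<in> {x \<in> topspace (subtopology Z D). h (s x, q x) \<in> N}"
        using z True by simp
      ultimately show ?thesis
        by (intro exI conjI) auto
    next
      case False
      let ?P = "prod_topology (top_of_set {0..1}) Y"
      let ?B = "{p \<in> topspace ?P. h p \<in> N}"
      have "openin ?P ?B"
        by (rule openin_continuous_map_preimage[OF h N])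
      moreover have "compactin (top_of_set {0..1::real}) {0..1}"
        by (simp add: compactin_subtopology)
      moreover have "q z \<in> topspace Y"
        using z qY by simp
      moreover have "{0..1} \<times> {q z} \<subseteq> ?B"
        using const[of z] False z qY s01[of z] by auto
      \<comment> \<open>By the tube lemma, near \<open>q z\<close> the homotopy stays in
        \<open>N\<close> for every time parameter, whatever values \<open>s\<close> takes.\<close>
      ultimately obtain I M where M: "openin Y M" "{0..1} \<subseteq> I" "q z \<in> M" "I \<times> M \<subseteq> ?B"
        using tube_lemma_left[of "top_of_set {0..1}" Y ?B "{0..1}" "q z"] by blast
      have "openin Z {x \<in> topspace Z. q x \<in> M}"
        by (rule openin_continuous_map_preimage[OF q M(1)])
      moreover have "{x \<in> topspace Z. q x \<in> M} \<subseteq> ?A"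
        using M(2,4) s01 by blast
      ultimately show ?thesis
        using z M(3) by blast
    qed
  qed
qed

section \<open>Based contractions and coordinate motions\<close>

lemma homotopic_with_True_iff:
  "homotopic_with (\<lambda>_. True) X Y p q \<longleftrightarrow>
    (\<exists>h. continuous_map (prod_topology (top_of_set {0..1::real}) X) Y h \<and>
      (\<forall>x\<in>topspace X. h (0, x) = p x) \<and> (\<forall>x\<in>topspace X. h (1, x) = q x))"
  by (subst homotopic_with) simp_all

context top_group
begin

text \<open>Puts a categorical cover into the form used by the planners: positivity sets,
  contractions ending at \<open>\<one>\<close>, and \<open>\<one>\<close> in the first set only,
  where it stays fixed.\<close>

lemma ex_based_categorical_cover:
  assumes cat: "cat_le T n" and H: "Hausdorff_space T" and pc: "path_connected_space T"
    and norm: "normal_space T"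
  obtains f :: "nat \<Rightarrow> 'a \<Rightarrow> real" and h :: "nat \<Rightarrow> real \<times> 'a \<Rightarrow> 'a" where
    "\<And>j. j \<le> n \<Longrightarrow> continuous_map T euclideanreal (f j)"
    "\<And>x. x \<in> topspace T \<Longrightarrow> \<exists>j\<le>n. f j x > 0"
    "\<And>j. 0 < j \<Longrightarrow> j \<le> n \<Longrightarrow> f j \<one> \<le> 0"
    "\<And>j. j \<le> n \<Longrightarrow> continuous_map
       (prod_topology (top_of_set {0..1}) (subtopology T {x \<in> topspace T. f j x > 0})) T (h j)"
    "\<And>j x. j \<le> n \<Longrightarrow> x \<in> topspace T \<Longrightarrow> f j x > 0 \<Longrightarrow> h j (0, x) = x \<and> h j (1, x) = \<one>"
    "\<And>t. t \<in> {0..1} \<Longrightarrow> h 0 (t, \<one>) = \<one>"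
proof -
  obtain U where U: "\<And>i. i \<le> n \<Longrightarrow> openin T (U i)"
    "\<And>i. i \<le> n \<Longrightarrow> \<exists>c. homotopic_with (\<lambda>_. True) (subtopology T (U i)) T id (\<lambda>_. c)"
    "topspace T \<subseteq> (\<Union>i\<le>n. U i)"
    using cat unfolding cat_le_def by blast
  obtain k where k: "k \<le> n" "\<one> \<in> U k"
    using U(3) one_in_topspace by auto
  \<comment> \<open>The set containing \<open>\<one>\<close> trades places with the set of index 0,
    and \<open>\<one>\<close> is deleted from all others. They still cover, since
    \<open>\<one>\<close> lies in \<open>V 0\<close>.\<close>
  define V where "V j = (if j = 0 then U k else if j = k then U 0 - {\<one>} else U j - {\<one>})" for j
  have sub: "\<exists>i\<le>n. V j \<subseteq> U i" if "j \<le> n" for j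
    using that k(1) by (auto simp: V_def)
  have clo1: "closedin T {\<one>}"
    using H one_in_topspace by (simp add: closedin_Hausdorff_singleton)
  have Vopen: "openin T (V j)" if "j \<le> n" for j
    using that U(1) k(1) clo1 by (auto simp: V_def openin_diff)
  have Vcover: "topspace T \<subseteq> {} \<union> (\<Union>j\<in>{..n}. V j)"
  proof
    fix x assume "x \<in> topspace T"
    then obtain i where i: "i \<le> n" "x \<in> U i" using U(3) by auto
    show "x \<in> {} \<union> (\<Union>j\<in>{..n}. V j)"
    proof (cases "x \<in> U k")
      case True
      then show ?thesis by (auto simp: V_def intro!: bexI[of _ 0])
    next
      case False
      then have "x \<in> V (if i = 0 then k else i)" "x \<noteq> \<one>"
        using i k by (auto simp: V_def)
      then show ?thesis using i k(1) by (auto split: if_splits)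
    qed
  qed
  obtain f :: "nat \<Rightarrow> 'a \<Rightarrow> real" where f: "\<And>j. j \<le> n \<Longrightarrow> continuous_map T euclideanreal (f j)"
      "\<And>j x. j \<le> n \<Longrightarrow> x \<in> topspace T \<Longrightarrow> f j x > 0 \<Longrightarrow> x \<in> V j"
      "\<And>x. x \<in> topspace T \<Longrightarrow> \<exists>j\<le>n. f j x > 0"
    using normal_space_cozero_shrinking[OF norm finite_atMost _ openin_empty Vcover] Vopen
    by (metis Diff_empty atMost_iff)
  let ?S = "\<lambda>j. {x \<in> topspace T. f j x > 0}"
  \<comment> \<open>The contraction to \<open>c\<close> is followed by a path from \<open>c\<close>
    to \<open>\<one>\<close>. Over an empty set \<open>c\<close> need not be a point of the space,
    so that case is separate.\<close>
  have contr: "homotopic_with (\<lambda>_. True) (subtopology T (?S j)) T id (\<lambda>_. \<one>)" if j: "j \<le> n" for j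
  proof (cases "subtopology T (?S j) = trivial_topology")
    case True
    then show ?thesis by (simp add: homotopic_on_emptyI)
  next
    case False
    obtain i where i: "i \<le> n" "V j \<subseteq> U i" using sub j by blast
    obtain c where "homotopic_with (\<lambda>_. True) (subtopology T (U i)) T id (\<lambda>_. c)"
      using U(2)[OF i(1)] by blast
    then have "homotopic_with (\<lambda>_. True) (subtopology (subtopology T (U i)) (?S j)) T id (\<lambda>_. c)"
      by (rule homotopic_from_subtopology)
    moreover have "subtopology (subtopology T (U i)) (?S j) = subtopology T (?S j)"
    proof -
      have "U i \<inter> ?S j = ?S j" using f(2)[OF j] i(2) by blast
      then show ?thesis by (simp add: subtopology_subtopology)
    qed
    ultimately have 1: "homotopic_with (\<lambda>_. True) (subtopology T (?S j)) T id (\<lambda>_. c)"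
      by simp
    then have "c \<in> topspace T"
      using False homotopic_with_imp_continuous_maps[OF 1] by simp
    then have "path_component_of T c \<one>"
      using pc one_in_topspace by (simp add: path_connected_space_iff_path_component)
    then have "homotopic_with (\<lambda>_. True) (subtopology T (?S j)) T (\<lambda>_. c) (\<lambda>_. \<one>)"
      by (simp add: homotopic_constant_maps)
    with 1 show ?thesis by (rule homotopic_with_trans)
  qed
  have "\<exists>g. continuous_map (prod_topology (top_of_set {0..1::real}) (subtopology T (?S j))) T g \<and>
      (\<forall>x\<in>?S j. g (0, x) = x \<and> g (1, x) = \<one>)" if "j \<le> n" for j
  proof -
    have top: "topspace (subtopology T (?S j)) = ?S j" by auto
    from contr[OF that, unfolded homotopic_with_True_iff top] obtain g where
      "continuous_map (prod_topology (top_of_set {0..1::real}) (subtopology T (?S j))) T g"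
      "\<forall>x\<in>?S j. g (0, x) = id x" "\<forall>x\<in>?S j. g (1, x) = \<one>"
      by (elim exE conjE) (rule that)
    then show ?thesis by (intro exI[of _ g]) simp
  qed
  then have "\<forall>j\<in>{..n}. \<exists>g. continuous_map (prod_topology (top_of_set {0..1::real}) (subtopology T (?S j))) T g \<and>
      (\<forall>x\<in>?S j. g (0, x) = x \<and> g (1, x) = \<one>)"
    by simp
  from bchoice[OF this] obtain g where
    g: "\<And>j. j \<le> n \<Longrightarrow> continuous_map (prod_topology (top_of_set {0..1::real}) (subtopology T (?S j))) T (g j)"
      "\<And>j x. j \<le> n \<Longrightarrow> x \<in> ?S j \<Longrightarrow> g j (0, x) = x \<and> g j (1, x) = \<one>"
    by auto
  have f1: "f j \<one> \<le> 0" if "0 < j" "j \<le> n" for j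
  proof (rule ccontr)
    assume "\<not> f j \<one> \<le> 0"
    then have "\<one> \<in> V j" using f(2) that one_in_topspace by force
    then show False using that by (auto simp: V_def split: if_splits)
  qed
  then have f0: "f 0 \<one> > 0"
    using f(3)[OF one_in_topspace] by (metis gr0I linorder_not_le)
  have one: "\<one> \<in> ?S 0" using f0 one_in_topspace by simp
  \<comment> \<open>Dividing by the track of \<^term>\<open>\<one>\<close> makes the contraction of the first set based.\<close>
  define h where "h j = (if j = 0 then (\<lambda>p. g 0 p \<otimes> inv (g 0 (fst p, \<one>))) else g j)" for j
  have g0top: "g 0 (t, x) \<in> topspace T" if "t \<in> {0..1}" "x \<in> ?S 0" for t x
  proof -
    have "(t, x) \<in> topspace (prod_topology (top_of_set {0..1::real}) (subtopology T (?S 0)))"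
      using that by simp
    then show ?thesis
      using g(1)[of 0] by (meson continuous_map_image_subset_topspace image_subset_iff le0)
  qed
  show thesis
  proof
    show "continuous_map (prod_topology (top_of_set {0..1::real}) (subtopology T {x \<in> topspace T. f j x > 0})) T (h j)"
      if "j \<le> n" for j
    proof (cases "j = 0")
      case True
      have "continuous_map (prod_topology (top_of_set {0..1::real}) (subtopology T (?S 0)))
          (prod_topology (top_of_set {0..1::real}) (subtopology T (?S 0))) (\<lambda>p. (fst p, \<one>))"
        using one by (intro continuous_map_pairedI continuous_map_fst) simp
      from continuous_map_compose[OF this g(1)[of 0]]
      have "continuous_map (prod_topology (top_of_set {0..1::real}) (subtopology T (?S 0))) T (\<lambda>p. g 0 (fst p, \<one>))"
        by (simp add: o_def)
      then show ?thesis
        using True g(1)[of 0] by (simp add: h_def continuous_map_mult continuous_map_inv)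
    qed (use g(1)[OF that] in \<open>simp add: h_def\<close>)
    show "h j (0, x) = x \<and> h j (1, x) = \<one>" if "j \<le> n" "x \<in> topspace T" "f j x > 0" for j x
      using g(2)[of j x] g(2)[of 0 \<one>] one that carrier_eq by (auto simp: h_def)
    show "h 0 (t, \<one>) = \<one>" if "t \<in> {0..1}" for t
      using g0top[OF that one] carrier_eq by (simp add: h_def)
  qed (use f f1 in auto)
qed

end

text \<open>The waiting times are chosen so that a coordinate starting at a zero of \<^term>\<open>d\<close> rests
until time 1/2 and one ending at a zero of \<^term>\<open>d\<close> rests from time 1/2 on.\<close>

definition delay :: "real \<Rightarrow> real \<Rightarrow> real \<Rightarrow> real" where
  "delay a b t = max 0 (min 1 ((2 * t - 1 + a) / (a + b)))"

lemma delay_range: "delay a b t \<in> {0..1}"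
  by (simp add: delay_def)

text \<open>For \<open>a + b > 0\<close> the quotient before clipping grows linearly from 0 at
  \<open>t = (1 - a) / 2\<close> to 1 at \<open>t = (1 + b) / 2\<close>. With \<open>a = 0\<close>
  the motion starts at 1/2; if also \<open>b = 0\<close>, division by zero yields 0.\<close>

lemma delay_first_half: "delay 0 b t = 0" if "0 \<le> b" "t \<le> 1/2"
proof -
  have "(2 * t - 1) / b \<le> 0"
    using that by (intro divide_nonpos_nonneg) auto
  then show ?thesis by (simp add: delay_def)
qed

lemma delay_second_half: "delay a 0 t = 1" if "0 < a" "1/2 \<le> t"
  using that by (simp add: delay_def)

lemma delay_0: "delay a b 0 = 0" if "0 \<le> a" "a \<le> 1" "0 \<le> b"
proof -
  have "(a - 1) / (a + b) \<le> 0"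
    using that by (intro divide_nonpos_nonneg) auto
  then show ?thesis by (simp add: delay_def)
qed

text \<open>Because \<open>b \<le> 1\<close> the ramp has ended by time 1. The sum
  \<open>a + b\<close> has to be positive, as \<open>delay 0 0\<close> is constantly 0.\<close>

lemma delay_1: "delay a b 1 = 1" if "0 \<le> a" "0 \<le> b" "b \<le> 1" "0 < a + b"
  using that by (simp add: delay_def)

text \<open>The gauge \<open>d\<close> vanishes at the neutral element only and serves as
  waiting-time parameter for both ends of a path.\<close>

locale gauged_group = top_group +
  fixes d :: "'a \<Rightarrow> real"
  assumes d_continuous: "continuous_map T euclideanreal d"
    and d_range: "x \<in> topspace T \<Longrightarrow> 0 \<le> d x \<and> d x \<le> 1"
    and d_eq_0: "x \<in> topspace T \<Longrightarrow> d x = 0 \<longleftrightarrow> x = \<one>"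
begin

definition move :: "(real \<times> 'a \<Rightarrow> 'a) \<Rightarrow> 'a \<Rightarrow> 'a \<Rightarrow> real \<Rightarrow> 'a" where
  "move h x y t = h (delay (d x) (d y) t, x \<otimes> inv y) \<otimes> y"

text \<open>The delay can be discontinuous only where both gauges vanish, that is, where both ends
  are \<open>\<one>\<close>. There the homotopy is constant by \<open>based\<close>, so
  \<open>continuous_map_homotopy_reparametrized\<close> applies with \<open>D\<close> the set where
  the sum of the gauges is positive.\<close>

lemma continuous_map_move:
  assumes h: "continuous_map (prod_topology (top_of_set {0..1}) (subtopology T V)) T h"
    and based: "\<And>t. \<one> \<in> V \<Longrightarrow> t \<in> {0..1} \<Longrightarrow> h (t, \<one>) = \<one>"
    and x: "continuous_map Z T x" and y: "continuous_map Z T y"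
    and \<tau>: "continuous_map Z euclideanreal \<tau>"
    and V: "\<And>z. z \<in> topspace Z \<Longrightarrow> x z \<otimes> inv (y z) \<in> V"
  shows "continuous_map Z T (\<lambda>z. move h (x z) (y z) (\<tau> z))"
proof -
  have xy: "x z \<in> topspace T" "y z \<in> topspace T" if "z \<in> topspace Z" for z
    using x y that by (auto simp: continuous_map_def)
  have dx: "continuous_map Z euclideanreal (\<lambda>z. d (x z))" "continuous_map Z euclideanreal (\<lambda>z. d (y z))"
    using continuous_map_compose[OF x d_continuous] continuous_map_compose[OF y d_continuous]
    by (simp_all add: o_def)
  define D where "D = {z \<in> topspace Z. d (x z) + d (y z) \<in> {0<..}}"
  have "openin Z D"
    unfolding D_def by (rule openin_continuous_map_preimage[where Y = euclideanreal])
      (auto intro!: continuous_intros dx)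
  have stay: "x z = \<one> \<and> y z = \<one>" if "z \<in> topspace Z - D" for z
    using that d_range[OF xy(1)[of z]] d_range[OF xy(2)[of z]] d_eq_0[OF xy(1)[of z]] d_eq_0[OF xy(2)[of z]]
    unfolding D_def by auto
  have "continuous_map Z T (\<lambda>z. h (delay (d (x z)) (d (y z)) (\<tau> z), x z \<otimes> inv (y z)))"
  proof (rule continuous_map_homotopy_reparametrized[OF h _ _ \<open>openin Z D\<close>, where w = "\<lambda>_. \<one>"])
    show "continuous_map Z (subtopology T V) (\<lambda>z. x z \<otimes> inv (y z))"
      using V by (auto simp: continuous_map_in_subtopology intro!: continuous_map_mult continuous_map_inv x y)
    show "continuous_map (subtopology Z D) euclideanreal (\<lambda>z. delay (d (x z)) (d (y z)) (\<tau> z))"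
      unfolding delay_def
      by (intro continuous_intros continuous_map_from_subtopology dx \<tau>) (auto simp: D_def)
    show "h (t, x z \<otimes> inv (y z)) = \<one>" if z: "z \<in> topspace Z - D" "t \<in> {0..1}" for z t
      using stay[OF z(1)] V[of z] z based[of t] by auto
  qed (rule delay_range)
  then show ?thesis
    unfolding move_def using y by (rule continuous_map_mult)
qed

text \<open>One pair of end points is fixed. The condition \<open>based\<close> is restricted to
  \<open>x = y\<close>, the only case in which the quotient \<open>x \<otimes> inv y\<close> is
  \<open>\<one>\<close>.\<close>

context
  fixes h :: "real \<times> 'a \<Rightarrow> 'a" and x y :: 'a
  assumes xy: "x \<in> topspace T" "y \<in> topspace T"
    and h0: "h (0, x \<otimes> inv y) = x \<otimes> inv y" and h1: "h (1, x \<otimes> inv y) = \<one>"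
    and based: "\<And>t. x = y \<Longrightarrow> t \<in> {0..1} \<Longrightarrow> h (t, \<one>) = \<one>"
begin

lemma move_same: "x = y \<Longrightarrow> move h x y t = x"
  using xy carrier_eq based delay_range by (simp add: move_def)

lemma move_if_delay_0: "delay (d x) (d y) t = 0 \<Longrightarrow> move h x y t = x"
  using xy[folded carrier_eq] h0 by (simp add: move_def m_assoc)

lemma move_if_delay_1: "delay (d x) (d y) t = 1 \<Longrightarrow> move h x y t = y"
  using xy carrier_eq h1 by (simp add: move_def)

lemma move_0: "move h x y 0 = x"
  using move_if_delay_0 delay_0 d_range xy by blast

lemma move_1: "move h x y 1 = y"
\<comment> \<open>If both ends are \<open>\<one>\<close>, the delay never reaches 1; the path is
  then constant.\<close>
proof (cases "x = y")
  case True
  then show ?thesis using move_same by simp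
next
  case False
  then have "0 < d x + d y"
    using d_range[OF xy(1)] d_range[OF xy(2)] d_eq_0[OF xy(1)] d_eq_0[OF xy(2)] by fastforce
  then show ?thesis
    using move_if_delay_1 delay_1 d_range xy by blast
qed

lemma move_first_half:
  assumes "x = \<one>" "t \<le> 1/2"
  shows "move h x y t = \<one>"
proof -
  have "d x = 0" using assms d_eq_0[OF xy(1)] by simp
  then show ?thesis
    using move_if_delay_0[of t] delay_first_half[of "d y" t] d_range[OF xy(2)] assms by simp
qed

lemma move_second_half:
  assumes "y = \<one>" "1/2 \<le> t"
  shows "move h x y t = \<one>"
\<comment> \<open>With both gauges 0 the delay is 0 instead of 1, so this case rests on
  \<open>move_same\<close>.\<close>
proof (cases "x = \<one>")
  case True
  then show ?thesis using move_same assms by simp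
next
  case False
  have "d y = 0" "0 < d x"
    using assms False d_eq_0[OF xy(2)] d_eq_0[OF xy(1)] d_range[OF xy(1)] by auto
  then show ?thesis
    using move_if_delay_1[of t] delay_second_half[of "d x" t] assms by simp
qed

end

end

text \<open>The neutral element lies in the first set of the cover only, so only the first contraction
has to be based.\<close>

locale covered_group = gauged_group +
  fixes n :: nat and f :: "nat \<Rightarrow> 'a \<Rightarrow> real" and h :: "nat \<Rightarrow> real \<times> 'a \<Rightarrow> 'a"
  assumes f_continuous: "j \<le> n \<Longrightarrow> continuous_map T euclideanreal (f j)"
    and f_cover: "x \<in> topspace T \<Longrightarrow> \<exists>j\<le>n. f j x > 0"
    and f_one: "0 < j \<Longrightarrow> j \<le> n \<Longrightarrow> f j \<one> \<le> 0"
    and h_continuous: "j \<le> n \<Longrightarrow> continuous_map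
      (prod_topology (top_of_set {0..1}) (subtopology T {x \<in> topspace T. f j x > 0})) T (h j)"
    and h_ends: "j \<le> n \<Longrightarrow> x \<in> topspace T \<Longrightarrow> f j x > 0 \<Longrightarrow> h j (0, x) = x \<and> h j (1, x) = \<one>"
    and h_based: "t \<in> {0..1} \<Longrightarrow> h 0 (t, \<one>) = \<one>"

text \<open>Normality, needed for positivity sets, comes from regularity and the Lindelof property;
  path-connectedness, needed to end contractions at \<open>\<one>\<close>, comes from the cell
  structure.\<close>

lemma (in top_group) ex_covered_group:
  assumes cw: "cw_complex T" and lc: "locally_compact_space T" and conn: "connected_space T"
    and cat: "cat_le T n"
  shows "\<exists>d f h. covered_group G T d n f h"
proof -
  obtain C where C: "cell_structure T C" using cw_complexE[OF cw] .
  have H: "Hausdorff_space T" using C by (simp add: cell_structure_def)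
  have pc: "path_connected_space T"
    using cell_structure.path_connected_if_connected[OF C conn] .
  have norm: "normal_space T"
    using Lindelof_space[OF lc conn] locally_compact_Hausdorff_imp_regular_space[OF lc H]
    by (simp add: regular_Lindelof_imp_normal_space)
  obtain d where "continuous_map T euclideanreal d"
    "\<And>x. x \<in> topspace T \<Longrightarrow> 0 \<le> d x \<and> d x \<le> 1"
    "\<And>x. x \<in> topspace T \<Longrightarrow> d x = 0 \<longleftrightarrow> x = \<one>"
    using ex_zero_set_one[OF cw lc] by metis
  then interpret gauged_group G T d
    by unfold_locales auto
  show ?thesis
  proof (rule ex_based_categorical_cover[OF cat H pc norm])
    fix f :: "nat \<Rightarrow> 'a \<Rightarrow> real" and h :: "nat \<Rightarrow> real \<times> 'a \<Rightarrow> 'a"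
    assume "\<And>j. j \<le> n \<Longrightarrow> continuous_map T euclideanreal (f j)"
      "\<And>x. x \<in> topspace T \<Longrightarrow> \<exists>j\<le>n. f j x > 0"
      "\<And>j. 0 < j \<Longrightarrow> j \<le> n \<Longrightarrow> f j \<one> \<le> 0"
      "\<And>j. j \<le> n \<Longrightarrow> continuous_map
         (prod_topology (top_of_set {0..1}) (subtopology T {x \<in> topspace T. f j x > 0})) T (h j)"
      "\<And>j x. j \<le> n \<Longrightarrow> x \<in> topspace T \<Longrightarrow> f j x > 0 \<Longrightarrow> h j (0, x) = x \<and> h j (1, x) = \<one>"
      "\<And>t. t \<in> {0..1} \<Longrightarrow> h 0 (t, \<one>) = \<one>"
    then have "covered_group G T d n f h"
      by unfold_locales
    then show ?thesis by blast
  qed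
qed

section \<open>Motion planners\<close>

lemma TCM_le_imp_TC_le: "TCM_le X n \<Longrightarrow> TC_le X n"
  unfolding TCM_le_def TC_le_def by meson

lemma motion_planner_subset:
  assumes "motion_planner X U H" "V \<subseteq> U"
  shows "motion_planner X V H"
proof -
  let ?X = "prod_topology X X" and ?I = "top_of_set {0..1::real}"
  have "continuous_map (subtopology (prod_topology (subtopology ?X U) ?I) (V \<times> {0..1})) X H"
    using assms(1) unfolding motion_planner_def by (blast intro: continuous_map_from_subtopology)
  also have "subtopology (prod_topology (subtopology ?X U) ?I) (V \<times> {0..1}) =
      prod_topology (subtopology (subtopology ?X U) V) (subtopology ?I {0..1})"
    by (simp only: subtopology_Times)
  also have "\<dots> = prod_topology (subtopology ?X V) ?I"
    using assms(2) by (simp add: subtopology_subtopology inf_absorb2)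
  finally show ?thesis
    using assms unfolding motion_planner_def by blast
qed

text \<open>Planners on disjoint open sets are pasted without any compatibility condition. This lets
  many regions count as a single set of a cover.\<close>

lemma motion_planner_disjoint_Union:
  fixes S :: "'i \<Rightarrow> ('a \<times> 'a) set"
  assumes op: "\<And>j. j \<in> J \<Longrightarrow> openin (prod_topology X X) (S j)"
    and mp: "\<And>j. j \<in> J \<Longrightarrow> motion_planner X (S j) (P j)"
    and disj: "\<And>i j p. i \<in> J \<Longrightarrow> j \<in> J \<Longrightarrow> p \<in> S i \<Longrightarrow> p \<in> S j \<Longrightarrow> i = j"
  obtains H where "motion_planner X (\<Union>j\<in>J. S j) H"
    "\<And>j p t. j \<in> J \<Longrightarrow> p \<in> S j \<Longrightarrow> H (p, t) = P j (p, t)"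
proof -
  let ?X = "prod_topology X X" and ?I = "top_of_set {0..1::real}"
  let ?Z = "prod_topology (subtopology ?X (\<Union>j\<in>J. S j)) ?I"
  define H where "H q = P (THE j. j \<in> J \<and> fst q \<in> S j) q" for q
  have H: "H (p, t) = P j (p, t)" if "j \<in> J" "p \<in> S j" for j p t
  proof -
    have "(THE j. j \<in> J \<and> p \<in> S j) = j"
      using that disj by blast
    then show ?thesis by (simp add: H_def)
  qed
  have "continuous_map ?Z X H"
  proof (rule pasting_lemma[where I = J and T = "\<lambda>j. S j \<times> {0..1}" and f = P])
    fix j assume j: "j \<in> J"
    have sub: "S j \<subseteq> topspace ?X" using op[OF j] openin_subset by blast
    have "openin (subtopology ?X (\<Union>j\<in>J. S j)) (S j)"
      using op[OF j] j by (simp add: openin_subtopology) blast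
    moreover have "openin ?I {0..1}"
      using openin_topspace[of ?I] by simp
    ultimately show "openin ?Z (S j \<times> {0..1})"
      by (simp add: openin_prod_Times_iff)
    have "subtopology ?Z (S j \<times> {0..1}) =
        prod_topology (subtopology (subtopology ?X (\<Union>j\<in>J. S j)) (S j)) (subtopology ?I {0..1})"
      by (simp only: subtopology_Times)
    also have "subtopology (subtopology ?X (\<Union>j\<in>J. S j)) (S j) = subtopology ?X (S j)"
      using j by (simp add: subtopology_subtopology inf_absorb2 SUP_upper)
    also have "subtopology ?I {0..1} = ?I"
      by (simp add: subtopology_subtopology)
    finally show "continuous_map (subtopology ?Z (S j \<times> {0..1})) X (P j)"
      using mp[OF j] by (simp add: motion_planner_def)
  next
    fix i j q assume "i \<in> J" "j \<in> J" "q \<in> topspace ?Z \<inter> S i \<times> {0..1} \<inter> S j \<times> {0..1}"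
    then show "P i q = P j q"
      using disj[of i j "fst q"] by auto
  next
    fix q assume "q \<in> topspace ?Z"
    then show "\<exists>j. j \<in> J \<and> q \<in> S j \<times> {0..1} \<and> H q = P j q"
      using H by fastforce
  qed
  moreover have "H (p, 0) = fst p \<and> H (p, 1) = snd p" if p: "p \<in> (\<Union>j\<in>J. S j)" for p
  proof -
    obtain j where j: "j \<in> J" "p \<in> S j" using p by blast
    then show ?thesis using mp[OF j(1)] by (simp add: H motion_planner_def)
  qed
  ultimately have "motion_planner X (\<Union>j\<in>J. S j) H"
    by (simp add: motion_planner_def)
  then show thesis using that H by blast
qed

section \<open>The lower bound\<close>

lemma topspace_polyhedral_product:
  "topspace (polyhedral_product m K T e) = polyhedral_product_set m K T e"
  by (auto simp: polyhedral_product_def polyhedral_product_set_def)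

lemma cat_le_product_if_TC_le:
  assumes K: "simplicial_complex m K" and \<sigma>: "\<sigma>1 \<in> K" "\<sigma>2 \<in> K"
    and e: "\<And>i. i \<in> {1..m} \<Longrightarrow> e i \<in> topspace (T i)"
    and TC: "TC_le (polyhedral_product m K T e) n"
  shows "cat_le (product_topology T (\<sigma>1 \<union> \<sigma>2)) n"
proof -
  let ?X = "polyhedral_product m K T e" and ?S = "\<sigma>1 \<union> \<sigma>2" and ?I = "top_of_set {0..1::real}"
  let ?P = "product_topology T ?S"
  have sub: "\<sigma>1 \<subseteq> {1..m}" "\<sigma>2 \<subseteq> {1..m}" "\<sigma>2 - \<sigma>1 \<in> K"
    using K \<sigma> unfolding simplicial_complex_def by blast+
  define emb where "emb \<sigma> z = (\<lambda>i\<in>{1..m}. if i \<in> \<sigma> then z i else e i)" for \<sigma> z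
  have emb: "continuous_map ?P ?X (emb \<sigma>)" if \<sigma>: "\<sigma> \<in> K" "\<sigma> \<subseteq> ?S" for \<sigma>
  proof -
    have c: "continuous_map ?P (product_topology T {1..m}) (emb \<sigma>)"
      unfolding continuous_map_componentwise
    proof (intro conjI ballI)
      fix i assume i: "i \<in> {1..m}"
      show "continuous_map ?P (T i) (\<lambda>z. emb \<sigma> z i)"
      proof (cases "i \<in> \<sigma>")
        case True
        then show ?thesis
          using i \<sigma>(2) by (auto simp: emb_def intro!: continuous_map_product_projection)
      qed (use i e in \<open>simp add: emb_def\<close>)
    qed (auto simp: emb_def)
    moreover have "emb \<sigma> z \<in> polyhedral_product_set m K T e" if "z \<in> topspace ?P" for z
    proof -
      have "emb \<sigma> z \<in> topspace (product_topology T {1..m})"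
        by (rule funcset_mem[OF continuous_map_funspace[OF c] that])
      moreover have "\<forall>i\<in>{1..m} - \<sigma>. emb \<sigma> z i = e i"
        by (simp add: emb_def)
      ultimately show ?thesis
        unfolding polyhedral_product_set_def using \<sigma>(1) by blast
    qed
    ultimately show ?thesis
      unfolding polyhedral_product_def by (auto simp: continuous_map_in_subtopology)
  qed
  \<comment> \<open>Every coordinate in \<open>?S\<close> is carried by exactly one of the two
    points; the other point has the base value there. This is why \<open>\<sigma>1\<close> is
    removed from \<open>\<sigma>2\<close>.\<close>
  define \<iota> where "\<iota> z = (emb \<sigma>1 z, emb (\<sigma>2 - \<sigma>1) z)" for z
  have \<iota>: "continuous_map ?P (prod_topology ?X ?X) \<iota>"
    unfolding \<iota>_def using \<sigma> sub by (intro continuous_map_pairedI emb) auto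
  obtain U where U: "\<And>k. k \<le> n \<Longrightarrow> openin (prod_topology ?X ?X) (U k)"
      "\<And>k. k \<le> n \<Longrightarrow> \<exists>H. motion_planner ?X (U k) H"
      "topspace (prod_topology ?X ?X) \<subseteq> (\<Union>k\<le>n. U k)"
    using TC unfolding TC_le_def by blast
  define V where "V k = {z \<in> topspace ?P. \<iota> z \<in> U k}" for k
  have "homotopic_with (\<lambda>_. True) (subtopology ?P (V k)) ?P id (\<lambda>_. \<lambda>i\<in>?S. e i)" if k: "k \<le> n" for k
  proof -
    obtain H where H: "motion_planner ?X (U k) H" using U(2)[OF k] by blast
    let ?Z = "prod_topology ?I (subtopology ?P (V k))"
    have HX: "continuous_map ?Z (T i) (\<lambda>q. H (\<iota> (snd q), \<tau> (fst q)) i)"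
      if i: "i \<in> ?S" and \<tau>: "continuous_map ?I ?I \<tau>" for i \<tau>
    proof -
      have "continuous_map ?Z (subtopology (prod_topology ?X ?X) (U k)) (\<lambda>q. \<iota> (snd q))"
      proof -
        have "continuous_map (subtopology ?P (V k)) (subtopology (prod_topology ?X ?X) (U k)) \<iota>"
          using continuous_map_from_subtopology[OF \<iota>] by (auto simp: continuous_map_in_subtopology V_def)
        from continuous_map_compose[OF continuous_map_snd this] show ?thesis by (simp add: o_def)
      qed
      moreover have "continuous_map ?Z ?I (\<lambda>q. \<tau> (fst q))"
        using continuous_map_compose[OF continuous_map_fst \<tau>] by (simp add: o_def)
      ultimately have "continuous_map ?Z (prod_topology (subtopology (prod_topology ?X ?X) (U k)) ?I)
          (\<lambda>q. (\<iota> (snd q), \<tau> (fst q)))"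
        by (rule continuous_map_pairedI)
      moreover have "continuous_map (prod_topology (subtopology (prod_topology ?X ?X) (U k)) ?I) ?X H"
        using H by (simp add: motion_planner_def)
      ultimately have "continuous_map ?Z ?X (\<lambda>q. H (\<iota> (snd q), \<tau> (fst q)))"
        using continuous_map_compose by (fastforce simp: o_def)
      moreover have "continuous_map ?X (T i) (\<lambda>x. x i)"
        unfolding polyhedral_product_def using i sub
        by (intro continuous_map_from_subtopology continuous_map_product_projection) auto
      ultimately show ?thesis
        using continuous_map_compose by (fastforce simp: o_def)
    qed
    \<comment> \<open>On \<open>\<sigma>1\<close> the planned path leads from \<open>z i\<close> to
      \<open>e i\<close>; on the remaining coordinates it leads from \<open>e i\<close> to
      \<open>z i\<close> and is read backwards. Mixing the two times is harmless, since
      \<open>g\<close> only has to stay in the full product \<open>?P\<close>.\<close>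
    define g where "g q = (\<lambda>i\<in>?S. if i \<in> \<sigma>1 then H (\<iota> (snd q), fst q) i else H (\<iota> (snd q), 1 - fst q) i)"
      for q :: "real \<times> (nat \<Rightarrow> 'a)"
    have "continuous_map ?Z ?P g"
      unfolding continuous_map_componentwise
    proof (intro conjI ballI)
      fix i assume i: "i \<in> ?S"
      have "continuous_map ?I ?I (\<lambda>t. t)" "continuous_map ?I ?I (\<lambda>t. 1 - t)"
        by (auto simp: continuous_map_in_subtopology intro!: continuous_intros)
      from this[THEN HX[OF i]] show "continuous_map ?Z (T i) (\<lambda>q. g q i)"
        using i by (cases "i \<in> \<sigma>1") (auto simp: g_def)
    qed (auto simp: g_def)
    moreover have "g (0, z) = z \<and> g (1, z) = (\<lambda>i\<in>?S. e i)" if z: "z \<in> V k" for z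
    proof -
      have "\<iota> z \<in> U k" using z by (simp add: V_def)
      then have H01: "H (\<iota> z, 0) = emb \<sigma>1 z" "H (\<iota> z, 1) = emb (\<sigma>2 - \<sigma>1) z"
        using H by (auto simp: motion_planner_def \<iota>_def)
      have zext: "z \<in> extensional ?S"
        using z by (auto simp: V_def PiE_def)
      have "g (0, z) i = z i \<and> g (1, z) i = e i" if "i \<in> ?S" for i
        using that sub by (auto simp: g_def H01 emb_def)
      then show ?thesis
        by (intro conjI extensionalityI[where A = ?S]) (auto simp: g_def zext)
    qed
    ultimately show ?thesis
      unfolding homotopic_with_True_iff by (intro exI[of _ g]) simp
  qed
  moreover have "openin ?P (V k)" if "k \<le> n" for k
    unfolding V_def by (rule openin_continuous_map_preimage[OF \<iota> U(1)[OF that]])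
  moreover have "topspace ?P \<subseteq> (\<Union>k\<le>n. V k)"
  proof
    fix z assume z: "z \<in> topspace ?P"
    then have "\<iota> z \<in> topspace (prod_topology ?X ?X)"
      by (rule funcset_mem[OF continuous_map_funspace[OF \<iota>]])
    then show "z \<in> (\<Union>k\<le>n. V k)"
      unfolding V_def using U(3) z by blast
  qed
  ultimately show ?thesis
    unfolding cat_le_def by blast
qed

section \<open>The upper bound\<close>

lemma openin_Collect_finite_ball:
  assumes "finite I" "\<And>i. i \<in> I \<Longrightarrow> openin X {x \<in> topspace X. P i x}"
  shows "openin X {x \<in> topspace X. \<forall>i\<in>I. P i x}"
  using assms
proof (induction rule: finite_induct)
  case empty
  then show ?case by simp
next
  case (insert a I)
  then have "openin X ({x \<in> topspace X. P a x} \<inter> {x \<in> topspace X. \<forall>i\<in>I. P i x})"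
    by (intro openin_Int) auto
  moreover have "{x \<in> topspace X. P a x} \<inter> {x \<in> topspace X. \<forall>i\<in>I. P i x} =
      {x \<in> topspace X. \<forall>i\<in>insert a I. P i x}"
    by auto
  ultimately show ?case by simp
qed

lemma openin_Collect_less:
  assumes "continuous_map X euclideanreal f" "continuous_map X euclideanreal g"
  shows "openin X {x \<in> topspace X. f x < g x}"
proof -
  have "openin X {x \<in> topspace X. g x - f x \<in> {0<..}}"
    by (rule openin_continuous_map_preimage[where Y = euclideanreal])
      (auto intro!: continuous_intros assms)
  then show ?thesis by simp
qed

section \<open>The cover of the square of the polyhedral product and its planners\<close>

locale group_family =
  fixes m :: nat and K :: "nat set set" and G :: "nat \<Rightarrow> ('a, 'b) monoid_scheme"
    and T :: "nat \<Rightarrow> 'a topology" and d :: "nat \<Rightarrow> 'a \<Rightarrow> real" and n :: "nat \<Rightarrow> nat"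
    and f :: "nat \<Rightarrow> nat \<Rightarrow> 'a \<Rightarrow> real" and h :: "nat \<Rightarrow> nat \<Rightarrow> real \<times> 'a \<Rightarrow> 'a"
  assumes complex: "simplicial_complex m K"
    and covered: "i \<in> {1..m} \<Longrightarrow> covered_group (G i) (T i) (d i) (n i) (f i) (h i)"
begin

lemmas f_continuous = covered_group.f_continuous[OF covered]
lemmas f_cover = covered_group.f_cover[OF covered]
lemmas f_one = covered_group.f_one[OF covered]
lemmas h_continuous = covered_group.h_continuous[OF covered]
lemmas h_ends = covered_group.h_ends[OF covered]
lemmas h_based = covered_group.h_based[OF covered]
lemmas gauged = covered_group.axioms(1)[OF covered]

abbreviation X :: "(nat \<Rightarrow> 'a) topology" where
  "X \<equiv> polyhedral_product m K T (\<lambda>i. \<one>\<^bsub>G i\<^esub>)"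

abbreviation XX :: "((nat \<Rightarrow> 'a) \<times> (nat \<Rightarrow> 'a)) topology" where
  "XX \<equiv> prod_topology X X"

definition quot :: "(nat \<Rightarrow> 'a) \<times> (nat \<Rightarrow> 'a) \<Rightarrow> nat \<Rightarrow> 'a" where
  "quot p i = fst p i \<otimes>\<^bsub>G i\<^esub> inv\<^bsub>G i\<^esub> (snd p i)"

text \<open>The strict inequalities between the functions make sets with incomparable indices disjoint.\<close>

definition region :: "(nat \<Rightarrow> nat) \<Rightarrow> ((nat \<Rightarrow> 'a) \<times> (nat \<Rightarrow> 'a)) set" where
  "region J = {p \<in> topspace XX. (\<forall>i\<in>{1..m}. 0 < f i (J i) (quot p i)) \<and>
     (\<forall>i\<in>{1..m}. \<forall>k\<in>{1..m}. \<forall>j\<in>{..<J k}. f k j (quot p k) < f i (J i) (quot p i))}"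

definition indices :: "(nat \<Rightarrow> nat) set" where
  "indices = PiE {1..m} (\<lambda>i. {..n i})"

definition plan :: "(nat \<Rightarrow> nat) \<Rightarrow> ((nat \<Rightarrow> 'a) \<times> (nat \<Rightarrow> 'a)) \<times> real \<Rightarrow> nat \<Rightarrow> 'a" where
  "plan J = (\<lambda>(p, t). \<lambda>i\<in>{1..m}. gauged_group.move (G i) (d i) (h i (J i)) (fst p i) (snd p i) t)"

lemma indexD: "J \<in> indices \<Longrightarrow> i \<in> {1..m} \<Longrightarrow> J i \<le> n i"
  by (auto simp: indices_def PiE_def)

lemma top_group: "i \<in> {1..m} \<Longrightarrow> top_group (G i) (T i)"
  using gauged by (simp add: gauged_group_def)

lemma one_in_T: "i \<in> {1..m} \<Longrightarrow> \<one>\<^bsub>G i\<^esub> \<in> topspace (T i)"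
  by (rule top_group.one_in_topspace[OF top_group])

lemma coordinate_continuous: "i \<in> {1..m} \<Longrightarrow> continuous_map X (T i) (\<lambda>x. x i)"
  unfolding polyhedral_product_def
  by (intro continuous_map_from_subtopology continuous_map_product_projection)

lemma fst_coordinate_continuous: "i \<in> {1..m} \<Longrightarrow> continuous_map XX (T i) (\<lambda>p. fst p i)"
  using continuous_map_compose[OF continuous_map_fst coordinate_continuous] by (simp add: o_def)

lemma snd_coordinate_continuous: "i \<in> {1..m} \<Longrightarrow> continuous_map XX (T i) (\<lambda>p. snd p i)"
  using continuous_map_compose[OF continuous_map_snd coordinate_continuous] by (simp add: o_def)

lemma quot_continuous:
  assumes "i \<in> {1..m}"
  shows "continuous_map XX (T i) (\<lambda>p. quot p i)"
proof -
  interpret top_group "G i" "T i" using top_group[OF assms] .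
  show ?thesis
    unfolding quot_def
    by (intro continuous_map_mult continuous_map_inv fst_coordinate_continuous
        snd_coordinate_continuous assms)
qed

lemma quot_in_T: "i \<in> {1..m} \<Longrightarrow> p \<in> topspace XX \<Longrightarrow> quot p i \<in> topspace (T i)"
  using funcset_mem[OF continuous_map_funspace[OF quot_continuous]] .

lemma coordinates_in_T:
  assumes "i \<in> {1..m}" "p \<in> topspace XX"
  shows "fst p i \<in> topspace (T i)" "snd p i \<in> topspace (T i)"
  using funcset_mem[OF continuous_map_funspace[OF fst_coordinate_continuous[OF assms(1)]] assms(2)]
    funcset_mem[OF continuous_map_funspace[OF snd_coordinate_continuous[OF assms(1)]] assms(2)] .

lemma quot_eq_one:
  assumes "i \<in> {1..m}" "p \<in> topspace XX" "fst p i = snd p i"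
  shows "quot p i = \<one>\<^bsub>G i\<^esub>"
proof -
  interpret top_group "G i" "T i" using top_group[OF assms(1)] .
  show ?thesis
    using coordinates_in_T[OF assms(1,2), folded carrier_eq] assms(3) by (simp add: quot_def)
qed

lemma f_quot_continuous:
  assumes "i \<in> {1..m}" "j \<le> n i"
  shows "continuous_map XX euclideanreal (\<lambda>p. f i j (quot p i))"
  using continuous_map_compose[OF quot_continuous[OF assms(1)] f_continuous[OF assms]]
  by (simp add: o_def)

lemma f_0_one: "i \<in> {1..m} \<Longrightarrow> 0 < f i 0 \<one>\<^bsub>G i\<^esub>"
  using f_cover[OF _ one_in_T, of i] f_one[of i] by (metis gr0I linorder_not_le)

text \<open>Positivity at the neutral element forces \<open>j = 0\<close>, and the contraction of
  the first set is based.\<close>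

lemma h_based_if_pos:
  assumes "i \<in> {1..m}" "j \<le> n i" "0 < f i j \<one>\<^bsub>G i\<^esub>" "t \<in> {0..1}"
  shows "h i j (t, \<one>\<^bsub>G i\<^esub>) = \<one>\<^bsub>G i\<^esub>"
  using assms f_one[of i j] h_based[of i t] by (cases "j = 0") auto

lemma openin_region:
  assumes J: "J \<in> indices"
  shows "openin XX (region J)"
proof -
  have "openin XX {p \<in> topspace XX. \<forall>i\<in>{1..m}. 0 < f i (J i) (quot p i)}"
    by (intro openin_Collect_finite_ball openin_Collect_less f_quot_continuous indexD[OF J]
        continuous_map_canonical_const finite_atLeastAtMost)
  moreover have "openin XX {p \<in> topspace XX. \<forall>i\<in>{1..m}. \<forall>k\<in>{1..m}. \<forall>j\<in>{..<J k}.
      f k j (quot p k) < f i (J i) (quot p i)}"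
    using indexD[OF J]
    by (intro openin_Collect_finite_ball openin_Collect_less f_quot_continuous)
      (auto intro: less_imp_le order_less_le_trans)
  ultimately have "openin XX ({p \<in> topspace XX. \<forall>i\<in>{1..m}. 0 < f i (J i) (quot p i)} \<inter>
     {p \<in> topspace XX. \<forall>i\<in>{1..m}. \<forall>k\<in>{1..m}. \<forall>j\<in>{..<J k}. f k j (quot p k) < f i (J i) (quot p i)})"
    by (rule openin_Int)
  moreover have "\<dots> = region J"
    unfolding region_def by blast
  ultimately show ?thesis by simp
qed

text \<open>Different indices with equal sums are incomparable: \<open>J i < L i\<close> and
  \<open>L k < J k\<close> for some \<open>i\<close> and \<open>k\<close>. The two regions then
  demand opposite strict inequalities between the same two function values.\<close>

lemma region_disjoint:
  assumes J: "J \<in> indices" "L \<in> indices" and sum: "sum J {1..m} = sum L {1..m}"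
    and p: "p \<in> region J" "p \<in> region L"
  shows "J = L"
proof (rule ccontr)
  assume "J \<noteq> L"
  then obtain i0 where i0: "i0 \<in> {1..m}" "J i0 \<noteq> L i0"
    using J unfolding indices_def by (metis PiE_ext)
  \<comment> \<open>Otherwise \<open>B\<close> is pointwise at most \<open>A\<close>, and equal sums
    force equality at \<open>i0\<close>.\<close>
  have ex: "\<exists>i\<in>{1..m}. A i < B i" if "sum A {1..m} = sum B {1..m}" "A i0 \<noteq> B i0" for A B :: "nat \<Rightarrow> nat"
  proof (rule ccontr)
    assume "\<not> ?thesis"
    then have "A i0 = B i0"
      using sum_mono_inv[of B "{1..m}" A i0] that(1) i0(1) by force
    then show False using that(2) by simp
  qed
  obtain i where i: "i \<in> {1..m}" "J i < L i" using ex[of J L] sum i0 by auto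
  obtain k where k: "k \<in> {1..m}" "L k < J k" using ex[of L J] sum i0 by auto
  have "f k (L k) (quot p k) < f i (J i) (quot p i)"
    using p(1) i k unfolding region_def by blast
  moreover have "f i (J i) (quot p i) < f k (L k) (quot p k)"
    using p(2) i k unfolding region_def by blast
  ultimately show False by simp
qed

lemma plan_in_coordinate:
  assumes J: "J \<in> indices" and p: "p \<in> region J" and i: "i \<in> {1..m}"
  shows "plan J (p, 0) i = fst p i" "plan J (p, 1) i = snd p i"
    "fst p i = snd p i \<Longrightarrow> plan J (p, t) i = fst p i"
    "\<lbrakk>fst p i = \<one>\<^bsub>G i\<^esub>; t \<le> 1/2\<rbrakk> \<Longrightarrow> plan J (p, t) i = \<one>\<^bsub>G i\<^esub>"
    "\<lbrakk>snd p i = \<one>\<^bsub>G i\<^esub>; 1/2 \<le> t\<rbrakk> \<Longrightarrow> plan J (p, t) i = \<one>\<^bsub>G i\<^esub>"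
proof -
  interpret gauged_group "G i" "T i" "d i" using gauged[OF i] .
  have pX: "p \<in> topspace XX" and pos: "0 < f i (J i) (quot p i)"
    using p i unfolding region_def by blast+
  note ends = h_ends[OF i indexD[OF J i] quot_in_T[OF i pX] pos, unfolded quot_def]
  have based: "h i (J i) (t, \<one>\<^bsub>G i\<^esub>) = \<one>\<^bsub>G i\<^esub>" if "fst p i = snd p i" "t \<in> {0..1}" for t
    using h_based_if_pos[OF i indexD[OF J i] _ that(2)] pos quot_eq_one[OF i pX that(1)] by simp
  note prems = coordinates_in_T[OF i pX] ends[THEN conjunct1] ends[THEN conjunct2] based
  show "plan J (p, 0) i = fst p i" "plan J (p, 1) i = snd p i"
    "fst p i = snd p i \<Longrightarrow> plan J (p, t) i = fst p i"
    "\<lbrakk>fst p i = \<one>\<^bsub>G i\<^esub>; t \<le> 1/2\<rbrakk> \<Longrightarrow> plan J (p, t) i = \<one>\<^bsub>G i\<^esub>"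
    "\<lbrakk>snd p i = \<one>\<^bsub>G i\<^esub>; 1/2 \<le> t\<rbrakk> \<Longrightarrow> plan J (p, t) i = \<one>\<^bsub>G i\<^esub>"
    using i move_0[OF prems] move_1[OF prems] move_same[OF prems]
      move_first_half[OF prems] move_second_half[OF prems]
    by (simp_all add: plan_def)
qed

lemma in_X_iff: "x \<in> topspace X \<longleftrightarrow> x \<in> topspace (product_topology T {1..m}) \<and>
    (\<exists>\<sigma>\<in>K. \<forall>i\<in>{1..m} - \<sigma>. x i = \<one>\<^bsub>G i\<^esub>)"
  unfolding topspace_polyhedral_product polyhedral_product_set_def by blast

text \<open>Up to time 1/2 the moving point is trivial wherever the start is, and from then on
  wherever the end is. At each time one of the simplices \<open>\<sigma>1\<close>,
  \<open>\<sigma>2\<close> therefore witnesses that the point lies in \<open>X\<close>.\<close>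

lemma motion_planner_plan:
  assumes J: "J \<in> indices"
  shows "motion_planner X (region J) (plan J)"
proof -
  let ?Z = "prod_topology (subtopology XX (region J)) (top_of_set {0..1::real})"
  have Z: "fst q \<in> region J" "fst q \<in> topspace XX" "snd q \<in> {0..1}" if "q \<in> topspace ?Z" for q
    using that by auto
  have fstZ: "continuous_map ?Z XX fst"
    using continuous_map_fst continuous_map_into_fulltopology by blast
  have cont: "continuous_map ?Z (product_topology T {1..m}) (plan J)"
    unfolding continuous_map_componentwise
  proof (intro conjI ballI)
    fix i assume i: "i \<in> {1..m}"
    interpret gauged_group "G i" "T i" "d i" using gauged[OF i] .
    have "continuous_map ?Z (T i) (\<lambda>q. move (h i (J i)) (fst (fst q) i) (snd (fst q) i) (snd q))"
    proof (rule continuous_map_move[OF h_continuous[OF i indexD[OF J i]]])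
      show "h i (J i) (t, \<one>\<^bsub>G i\<^esub>) = \<one>\<^bsub>G i\<^esub>"
        if "\<one>\<^bsub>G i\<^esub> \<in> {x \<in> topspace (T i). 0 < f i (J i) x}" "t \<in> {0..1}" for t
        using h_based_if_pos[OF i indexD[OF J i] _ that(2)] that(1) by blast
      show "continuous_map ?Z (T i) (\<lambda>q. fst (fst q) i)" "continuous_map ?Z (T i) (\<lambda>q. snd (fst q) i)"
        using continuous_map_compose[OF fstZ fst_coordinate_continuous[OF i]]
          continuous_map_compose[OF fstZ snd_coordinate_continuous[OF i]] by (simp_all add: o_def)
      show "continuous_map ?Z euclideanreal snd"
        using continuous_map_snd continuous_map_into_fulltopology by blast
      show "fst (fst q) i \<otimes>\<^bsub>G i\<^esub> inv\<^bsub>G i\<^esub> snd (fst q) i \<in> {x \<in> topspace (T i). 0 < f i (J i) x}"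
        if "q \<in> topspace ?Z" for q
        using Z(1)[OF that] quot_in_T[OF i Z(2)[OF that]] i unfolding region_def quot_def by blast
    qed
    then show "continuous_map ?Z (T i) (\<lambda>q. plan J q i)"
      using i by (simp add: plan_def split_beta)
  qed (auto simp: plan_def)
  have "plan J q \<in> topspace X" if q: "q \<in> topspace ?Z" for q
  proof -
    obtain p t where pt: "q = (p, t)" by fastforce
    have p: "p \<in> region J" "p \<in> topspace XX" using Z[OF q] pt by auto
    then have "fst p \<in> topspace X" "snd p \<in> topspace X" by auto
    then obtain \<sigma>1 \<sigma>2 where \<sigma>: "\<sigma>1 \<in> K" "\<forall>i\<in>{1..m} - \<sigma>1. fst p i = \<one>\<^bsub>G i\<^esub>"
        "\<sigma>2 \<in> K" "\<forall>i\<in>{1..m} - \<sigma>2. snd p i = \<one>\<^bsub>G i\<^esub>"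
      unfolding in_X_iff by blast
    have "\<exists>\<sigma>\<in>K. \<forall>i\<in>{1..m} - \<sigma>. plan J q i = \<one>\<^bsub>G i\<^esub>"
    proof (cases "t \<le> 1/2")
      case True
      then show ?thesis
        using \<sigma>(1,2) plan_in_coordinate(4)[OF J p(1)] pt by blast
    next
      case False
      then have "1/2 \<le> t" by simp
      then show ?thesis
        using \<sigma>(3,4) plan_in_coordinate(5)[OF J p(1)] pt by blast
    qed
    moreover have "plan J q \<in> topspace (product_topology T {1..m})"
      by (rule funcset_mem[OF continuous_map_funspace[OF cont] q])
    ultimately show ?thesis
      unfolding in_X_iff by blast
  qed
  then have "continuous_map ?Z X (plan J)"
    using cont unfolding polyhedral_product_def
    by (auto simp: continuous_map_in_subtopology)
  moreover have "plan J (p, 0) = fst p \<and> plan J (p, 1) = snd p" if p: "p \<in> region J" for p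
  proof -
    have "p \<in> topspace XX" using p by (simp add: region_def)
    then have "fst p \<in> topspace X" "snd p \<in> topspace X" by auto
    then have "fst p \<in> extensional {1..m}" "snd p \<in> extensional {1..m}"
      unfolding in_X_iff by (auto simp: PiE_def)
    then show ?thesis
      using plan_in_coordinate(1,2)[OF J p]
      by (intro conjI extensionalityI[where A = "{1..m}"]) (auto simp: plan_def)
  qed
  ultimately show ?thesis
    by (simp add: motion_planner_def)
qed

text \<open>The least choice makes all earlier functions nonpositive at the quotient, which yields
  the strict inequalities in \<open>region\<close>.\<close>

definition index_of :: "(nat \<Rightarrow> 'a) \<times> (nat \<Rightarrow> 'a) \<Rightarrow> nat \<Rightarrow> nat" where
  "index_of p = (\<lambda>i\<in>{1..m}. LEAST j. 0 < f i j (quot p i))"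

lemma index_of:
  assumes p: "p \<in> topspace XX" and i: "i \<in> {1..m}"
  shows "0 < f i (index_of p i) (quot p i)" "index_of p i \<le> n i"
    "j < index_of p i \<Longrightarrow> f i j (quot p i) \<le> 0"
proof -
  obtain k where k: "k \<le> n i" "0 < f i k (quot p i)"
    using f_cover[OF i quot_in_T[OF i p]] by blast
  have eq: "index_of p i = (LEAST j. 0 < f i j (quot p i))"
    using i by (simp add: index_of_def)
  show "0 < f i (index_of p i) (quot p i)"
    unfolding eq using k(2) by (rule LeastI)
  show "index_of p i \<le> n i"
    unfolding eq using k Least_le[of "\<lambda>j. 0 < f i j (quot p i)" k] by simp
  show "f i j (quot p i) \<le> 0" if "j < index_of p i"
    using not_less_Least[of j "\<lambda>j. 0 < f i j (quot p i)"] that unfolding eq by simp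
qed

lemma index_of_in_indices: "p \<in> topspace XX \<Longrightarrow> index_of p \<in> indices"
  using index_of(2) by (simp add: indices_def index_of_def PiE_iff)

lemma in_region_index_of:
  assumes p: "p \<in> topspace XX"
  shows "p \<in> region (index_of p)"
proof -
  have "f k j (quot p k) < f i (index_of p i) (quot p i)"
    if "i \<in> {1..m}" "k \<in> {1..m}" "j < index_of p k" for i j k
    using index_of(1)[OF p that(1)] index_of(3)[OF p that(2,3)] by linarith
  then show ?thesis
    unfolding region_def using p index_of(1)[OF p] by blast
qed

text \<open>Off \<open>\<sigma>1 \<union> \<sigma>2\<close> both coordinates are neutral, so the
  quotient is neutral and lies in the first set: the index is 0 there.\<close>

lemma sum_index_of_le:
  assumes p: "p \<in> topspace XX"
    and N: "\<And>\<sigma>1 \<sigma>2. \<sigma>1 \<in> K \<Longrightarrow> \<sigma>2 \<in> K \<Longrightarrow> (\<Sum>i\<in>\<sigma>1 \<union> \<sigma>2. n i) \<le> N"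
  shows "sum (index_of p) {1..m} \<le> N"
proof -
  have "fst p \<in> topspace X" "snd p \<in> topspace X" using p by auto
  then obtain \<sigma>1 \<sigma>2 where \<sigma>: "\<sigma>1 \<in> K" "\<forall>i\<in>{1..m} - \<sigma>1. fst p i = \<one>\<^bsub>G i\<^esub>"
      "\<sigma>2 \<in> K" "\<forall>i\<in>{1..m} - \<sigma>2. snd p i = \<one>\<^bsub>G i\<^esub>"
    unfolding in_X_iff by blast
  then have sub: "\<sigma>1 \<union> \<sigma>2 \<subseteq> {1..m}"
    using complex unfolding simplicial_complex_def by blast
  have "index_of p i = 0" if "i \<in> {1..m} - (\<sigma>1 \<union> \<sigma>2)" for i
  proof -
    have i: "i \<in> {1..m}" and "fst p i = snd p i" using that \<sigma> by auto
    then have "quot p i = \<one>\<^bsub>G i\<^esub>" using quot_eq_one[OF i p] by simp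
    then show ?thesis
      using index_of(3)[OF p i, of 0] f_0_one[OF i] by (metis gr0I linorder_not_le)
  qed
  then have "sum (index_of p) {1..m} = sum (index_of p) (\<sigma>1 \<union> \<sigma>2)"
    using sub by (intro sum.mono_neutral_right) auto
  also have "\<dots> \<le> (\<Sum>i\<in>\<sigma>1 \<union> \<sigma>2. n i)"
    using sub index_of(2)[OF p] by (intro sum_mono) blast
  also have "\<dots> \<le> N" using N \<sigma> by blast
  finally show ?thesis .
qed

text \<open>Only the first set of the cover by the sums of indices contains the diagonal. Each of the
others is cut away from a neighbourhood of the diagonal and united with a smaller one, on which the
first planner is reused.\<close>

lemma TCM_le_sum:
  assumes N: "\<And>\<sigma>1 \<sigma>2. \<sigma>1 \<in> K \<Longrightarrow> \<sigma>2 \<in> K \<Longrightarrow> (\<Sum>i\<in>\<sigma>1 \<union> \<sigma>2. n i) \<le> N"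
  shows "TCM_le X N"
proof -
  define Z :: "nat \<Rightarrow> nat" where "Z = (\<lambda>i\<in>{1..m}. 0)"
  have Z: "Z \<in> indices" by (auto simp: Z_def indices_def)
  \<comment> \<open>No number lies below 0, so the inequalities between different functions are
    vacuous for \<open>Z\<close>.\<close>
  have Z_region: "p \<in> region Z \<longleftrightarrow> p \<in> topspace XX \<and> (\<forall>i\<in>{1..m}. 0 < f i 0 (quot p i))" for p
    by (auto simp: region_def Z_def)
  \<comment> \<open>The threshold is half the value on the diagonal, which is positive by
    \<open>f_0_one\<close>. Hence \<open>near\<close> contains the diagonal and lies in
    \<open>region Z\<close>.\<close>
  define near where "near = {p \<in> topspace XX. \<forall>i\<in>{1..m}. f i 0 \<one>\<^bsub>G i\<^esub> / 2 < f i 0 (quot p i)}"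
  define far where "far = (\<Union>i\<in>{1..m}. {p \<in> topspace XX. f i 0 (quot p i) < f i 0 \<one>\<^bsub>G i\<^esub> / 2})"
  have "openin XX near"
    unfolding near_def
    by (intro openin_Collect_finite_ball openin_Collect_less f_quot_continuous
        continuous_map_canonical_const finite_atLeastAtMost) auto
  have "openin XX {p \<in> topspace XX. f i 0 (quot p i) < f i 0 \<one>\<^bsub>G i\<^esub> / 2}" if "i \<in> {1..m}" for i
    by (intro openin_Collect_less f_quot_continuous continuous_map_canonical_const that le0)
  then have "openin XX far"
    unfolding far_def by (intro openin_Union) blast
  have near_Z: "near \<subseteq> region Z"
  proof
    fix p assume "p \<in> near"
    then show "p \<in> region Z"
      unfolding Z_region near_def using f_0_one by (fastforce intro: order_less_trans[rotated])
  qed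
  have diag: "(x, x) \<in> near" if "x \<in> topspace X" for x
    unfolding near_def using that quot_eq_one[of _ "(x, x)"] f_0_one by auto
  have plan_diag: "plan Z ((x, x), t) = x" if x: "x \<in> topspace X" for x t
  proof -
    have reg: "(x, x) \<in> region Z" using diag[OF x] near_Z by blast
    have "x \<in> extensional {1..m}"
      using x unfolding in_X_iff by (auto simp: PiE_def)
    then show ?thesis
      using plan_in_coordinate(3)[OF Z reg]
      by (intro extensionalityI[where A = "{1..m}"]) (auto simp: plan_def)
  qed
  define level where "level k = {J \<in> indices. sum J {1..m} = k}" for k
  define W where "W k = (\<Union>J\<in>level k. region J)" for k
  \<comment> \<open>As \<open>near\<close> and \<open>far\<close> are disjoint, the planners of
    \<open>region Z\<close> and of \<open>W k\<close> can be used side by side. The set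
    \<open>U 0\<close> is \<open>region Z\<close>, the only region of level 0.\<close>
  define U where "U k = (if k = 0 then region Z else near \<union> (W k \<inter> far))" for k
  have W: "\<exists>H. motion_planner X (W k) H" "openin XX (W k)" for k
  proof -
    obtain H where "motion_planner X (\<Union>J\<in>level k. region J) H"
      by (rule motion_planner_disjoint_Union[where J = "level k" and X = X and S = region and P = plan])
        (auto simp: level_def openin_region motion_planner_plan intro: region_disjoint)
    then show "\<exists>H. motion_planner X (W k) H" unfolding W_def by blast
    show "openin XX (W k)"
      unfolding W_def using openin_region by (intro openin_Union) (auto simp: level_def)
  qed
  have U: "openin XX (U k) \<and> {(x, x) | x. x \<in> topspace X} \<subseteq> U k \<and>
      (\<exists>H. motion_planner X (U k) H \<and> (\<forall>x\<in>topspace X. \<forall>t\<in>{0..1}. H ((x, x), t) = x))" for k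
  proof (cases "k = 0")
    case True
    then have "U k = region Z" by (simp add: U_def)
    then show ?thesis
      using openin_region[OF Z] diag near_Z motion_planner_plan[OF Z] plan_diag by auto
  next
    case False
    then have Uk: "U k = near \<union> (W k \<inter> far)" by (simp add: U_def)
    obtain HW where HW: "motion_planner X (W k) HW" using W(1) by blast
    define S where "S b = (if b then near else W k \<inter> far)" for b
    have S: "U k = (\<Union>b\<in>UNIV. S b)"
      unfolding Uk S_def by (auto simp: UNIV_bool)
    obtain H where H: "motion_planner X (\<Union>b\<in>UNIV. S b) H"
      "\<And>b p t. b \<in> UNIV \<Longrightarrow> p \<in> S b \<Longrightarrow> H (p, t) = (if b then plan Z else HW) (p, t)"
    proof (rule motion_planner_disjoint_Union[where J = UNIV and X = X and S = S
          and P = "\<lambda>b. if b then plan Z else HW"])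
      show "openin XX (S b)" for b
        using \<open>openin XX near\<close> \<open>openin XX far\<close> W(2)[of k] by (auto simp: S_def)
      show "motion_planner X (S b) (if b then plan Z else HW)" for b
        using motion_planner_subset[OF motion_planner_plan[OF Z] near_Z]
          motion_planner_subset[OF HW, of "W k \<inter> far"] by (auto simp: S_def)
      have "near \<inter> far = {}" unfolding near_def far_def by fastforce
      then show "b = c" if "p \<in> S b" "p \<in> S c" for b c p
        using that by (cases b; cases c) (auto simp: S_def)
    qed blast
    have "H ((x, x), t) = x" if "x \<in> topspace X" for x t
      using H(2)[of True "(x, x)" t] diag[OF that] plan_diag[OF that] by (simp add: S_def)
    moreover have "openin XX (U k)"
      unfolding Uk using \<open>openin XX near\<close> \<open>openin XX far\<close> W(2)[of k] by blast
    moreover have "{(x, x) | x. x \<in> topspace X} \<subseteq> U k"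
      unfolding Uk using diag by blast
    ultimately show ?thesis
      using H(1) unfolding S by blast
  qed
  have cover: "topspace XX \<subseteq> (\<Union>k\<le>N. U k)"
  proof
    fix p assume p: "p \<in> topspace XX"
    let ?k = "sum (index_of p) {1..m}"
    have k: "?k \<le> N" using sum_index_of_le[OF p N] .
    show "p \<in> (\<Union>k\<le>N. U k)"
    proof (cases "p \<in> region Z")
      case True
      then have "p \<in> U 0" by (simp add: U_def)
      then show ?thesis by blast
    next
      case False
      have "?k \<noteq> 0"
      proof
        assume "?k = 0"
        then have "\<forall>i\<in>{1..m}. index_of p i = 0" by simp
        then have "index_of p = Z" by (auto simp: Z_def index_of_def fun_eq_iff)
        then show False using in_region_index_of[OF p] False by simp
      qed
      moreover have "p \<in> W ?k"
        unfolding W_def level_def using in_region_index_of[OF p] index_of_in_indices[OF p] by blast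
      \<comment> \<open>Outside \<open>region Z\<close> some first function is at most 0, hence
        below its threshold, so intersecting with \<open>far\<close> loses no such point.\<close>
      moreover have "p \<in> far"
      proof -
        obtain i where i: "i \<in> {1..m}" "f i 0 (quot p i) \<le> 0"
          using False p unfolding Z_region by (auto simp: not_less)
        then have "f i 0 (quot p i) < f i 0 \<one>\<^bsub>G i\<^esub> / 2"
          using f_0_one[OF i(1)] by simp
        then show ?thesis unfolding far_def using i(1) p by blast
      qed
      ultimately have "p \<in> U ?k" by (simp add: U_def del: sum_eq_0_iff)
      then show ?thesis using k by blast
    qed
  qed
  show ?thesis
    unfolding TCM_le_def by (intro exI[of _ U] conjI[OF _ cover] allI impI U)
qed

end

section \<open>From bounds by natural numbers to the extended invariants\<close>

lemma LS_cat_le_if: "cat_le X n \<Longrightarrow> LS_cat X \<le> enat n"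
  unfolding LS_cat_def by (rule Inf_lower) blast

text \<open>A finite infimum is attained: the infimum of the empty set is infinite, and a nonempty
  set of extended naturals has a least element.\<close>

lemma cat_le_if_LS_cat_eq:
  assumes "LS_cat X = enat n"
  shows "cat_le X n"
proof -
  let ?A = "{enat n |n. cat_le X n}"
  have "?A \<noteq> {}"
  proof
    assume "?A = {}"
    then show False using assms by (simp add: LS_cat_def Inf_enat_def)
  qed
  then have "Inf ?A \<in> ?A"
    by (auto simp: Inf_enat_def intro: LeastI)
  then show ?thesis
    using assms by (auto simp: LS_cat_def)
qed

theorem theorem1p1:
  fixes m :: nat and K :: "nat set set"
    and G :: "nat \<Rightarrow> ('a, 'b) monoid_scheme" and T :: "nat \<Rightarrow> 'a topology"
  assumes K: "simplicial_complex m K"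
    and grp: "\<And>i. i \<in> {1..m} \<Longrightarrow> topological_group (G i) (T i)"
    and lc: "\<And>i. i \<in> {1..m} \<Longrightarrow> locally_compact_space (T i)"
    and conn: "\<And>i. i \<in> {1..m} \<Longrightarrow> connected_space (T i)"
    and cw: "\<And>i. i \<in> {1..m} \<Longrightarrow> cw_complex (T i)"
    and LSlog: "\<And>S. S \<subseteq> {1..m} \<Longrightarrow> S \<noteq> {} \<Longrightarrow>
                  LS_cat (product_topology T S) = (\<Sum>i\<in>S. LS_cat (T i))"
  shows "TC (polyhedral_product m K T (\<lambda>i. \<one>\<^bsub>G i\<^esub>)) =
           TCM (polyhedral_product m K T (\<lambda>i. \<one>\<^bsub>G i\<^esub>)) \<and>
         TCM (polyhedral_product m K T (\<lambda>i. \<one>\<^bsub>G i\<^esub>)) =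
           Max {(\<Sum>i\<in>\<sigma>1 \<union> \<sigma>2. LS_cat (T i)) | \<sigma>1 \<sigma>2. \<sigma>1 \<in> K \<and> \<sigma>2 \<in> K}"
proof -
  let ?X = "polyhedral_product m K T (\<lambda>i. \<one>\<^bsub>G i\<^esub>)"
  let ?A = "{(\<Sum>i\<in>\<sigma>1 \<union> \<sigma>2. LS_cat (T i)) | \<sigma>1 \<sigma>2. \<sigma>1 \<in> K \<and> \<sigma>2 \<in> K}"
  have tg: "top_group (G i) (T i)" if "i \<in> {1..m}" for i
    using grp[OF that] by (simp add: top_group_def top_group_axioms_def topological_group_def)
  have sub: "\<sigma> \<subseteq> {1..m}" if "\<sigma> \<in> K" for \<sigma>
    using K that unfolding simplicial_complex_def by blast
  have "K \<subseteq> Pow {1..m}" using sub by blast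
  then have "finite K" by (rule finite_subset) simp
  have A: "?A = (\<lambda>(\<sigma>1, \<sigma>2). \<Sum>i\<in>\<sigma>1 \<union> \<sigma>2. LS_cat (T i)) ` (K \<times> K)"
    by auto
  have finA: "finite ?A" unfolding A using \<open>finite K\<close> by simp
  have "K \<noteq> {}" using K by (simp add: simplicial_complex_def)
  then have neA: "?A \<noteq> {}" unfolding A by simp
  have lower: "Max ?A \<le> TC ?X"
  proof -
    have "(\<Sum>i\<in>\<sigma>1 \<union> \<sigma>2. LS_cat (T i)) \<le> enat k"
      if \<sigma>: "\<sigma>1 \<in> K" "\<sigma>2 \<in> K" and k: "TC_le ?X k" for \<sigma>1 \<sigma>2 k
    \<comment> \<open>The logarithmic hypothesis concerns nonempty index sets; the empty sum is
      0.\<close>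
    proof (cases "\<sigma>1 \<union> \<sigma>2 = {}")
      case False
      have "cat_le (product_topology T (\<sigma>1 \<union> \<sigma>2)) k"
        by (rule cat_le_product_if_TC_le[OF K \<sigma> _ k]) (rule top_group.one_in_topspace[OF tg])
      then have "LS_cat (product_topology T (\<sigma>1 \<union> \<sigma>2)) \<le> enat k"
        by (rule LS_cat_le_if)
      moreover have "LS_cat (product_topology T (\<sigma>1 \<union> \<sigma>2)) = (\<Sum>i\<in>\<sigma>1 \<union> \<sigma>2. LS_cat (T i))"
        by (rule LSlog) (use False \<sigma> sub in auto)
      ultimately show ?thesis by simp
    qed simp
    then show ?thesis
      unfolding TC_def using finA neA by (intro Inf_greatest) (auto simp: Max_le_iff)
  qed
  have middle: "TC ?X \<le> TCM ?X"
    unfolding TC_def TCM_def by (intro Inf_superset_mono) (auto dest: TCM_le_imp_TC_le)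
  have upper: "TCM ?X \<le> Max ?A"
  proof (cases "Max ?A")
    case (enat N)
    have le: "(\<Sum>i\<in>\<sigma>1 \<union> \<sigma>2. LS_cat (T i)) \<le> enat N" if "\<sigma>1 \<in> K" "\<sigma>2 \<in> K" for \<sigma>1 \<sigma>2
      unfolding enat[symmetric] by (rule Max_ge[OF finA]) (use that in blast)
    \<comment> \<open>Every vertex is a simplex, so a finite maximum bounds the category of each
      factor.\<close>
    have "\<exists>n. LS_cat (T i) = enat n" if "i \<in> {1..m}" for i
    proof -
      have "{i} \<in> K" using K that unfolding simplicial_complex_def by blast
      then have "LS_cat (T i) \<le> enat N" using le[of "{i}" "{i}"] by simp
      then show ?thesis using enat_ile by blast
    qed
    then obtain n where n: "\<And>i. i \<in> {1..m} \<Longrightarrow> LS_cat (T i) = enat (n i)"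
      by metis
    have "\<exists>d f h. covered_group (G i) (T i) d (n i) f h" if i: "i \<in> {1..m}" for i
    proof -
      have "cat_le (T i) (n i)" using cat_le_if_LS_cat_eq[OF n[OF i]] .
      then show ?thesis
        using top_group.ex_covered_group[OF tg[OF i] cw[OF i] lc[OF i] conn[OF i]] by blast
    qed
    then obtain d f h where "\<And>i. i \<in> {1..m} \<Longrightarrow> covered_group (G i) (T i) (d i) (n i) (f i) (h i)"
      by metis
    then have "group_family m K G T d n f h"
      using K by (simp add: group_family_def)
    then have "TCM_le ?X N"
    proof (rule group_family.TCM_le_sum)
      fix \<sigma>1 \<sigma>2 assume \<sigma>: "\<sigma>1 \<in> K" "\<sigma>2 \<in> K"
      then have "(\<Sum>i\<in>\<sigma>1 \<union> \<sigma>2. LS_cat (T i)) = (\<Sum>i\<in>\<sigma>1 \<union> \<sigma>2. enat (n i))"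
        using sub n by (intro sum.cong) blast+
      also have "\<dots> = enat (\<Sum>i\<in>\<sigma>1 \<union> \<sigma>2. n i)"
        by (simp flip: of_nat_eq_enat)
      finally show "(\<Sum>i\<in>\<sigma>1 \<union> \<sigma>2. n i) \<le> N"
        using le[OF \<sigma>] by simp
    qed
    then show ?thesis
      unfolding enat TCM_def by (intro Inf_lower) blast
  qed simp
  show ?thesis
    using lower middle upper by (meson order.antisym order.trans)
qed

end
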